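(* Let $T$ be a tree on $n$ vertices with $\operatorname{diam}(T)=2d$, where $d\geq 2$ is an integer, and let $u_0$ be the center of $T$. Let $u_1,u_2,\dots,u_l$ be all the neighbours of $u_0$ with the following property: if $T_i$ denotes the component containing $u_i$ of the forest obtained from $T$ by deleting the edges $u_0u_1,\dots,u_0u_l$, then the eccentricity of $u_i$ within $T_i$ is $d-1$ (it is known that $l\geq 2$; equivalently, $u_1,\dots,u_l$ are exactly the neighbours of $u_0$ lying on some diametrical path of $T$). Then the inertia of the eccentricity matrix $\mathcal{E}(T)$ is $(l,l,n-2l)$.
   Context: For a connected graph $G$ with distance function $d(u,v)$, the eccentricity of a vertex $u$ is $e(u)=\max_{v}d(u,v)$. The eccentricity matrix $\mathcal{E}(G)$ is the matrix indexed by $V(G)$ with $\mathcal{E}(G)_{uv}=d(u,v)$ if $d(u,v)=\min\{e(u),e(v)\}$, and $\mathcal{E}(G)_{uv}=0$ otherwise. The diameter is the largest distance between two vertices; a diametrical path is a path of length equal to the diameter. A tree of even diameter has a unique center (the middle vertex of any diametrical path). The inertia of a real symmetric matrix is the triple of the numbers of its positive, negative and zero eigenvalues (with multiplicity). *)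

theory Defs
  imports "Graph_Theory.Graph_Theory" "Jordan_Normal_Form.Char_Poly"
begin

text \<open>
  A finite simple graph is a \<open>pair_graph\<close>: a finite, loop-free, symmetric set of arcs, so that an
  undirected edge \<open>uv\<close> is the pair of arcs \<open>(u, v)\<close> and \<open>(v, u)\<close>.

  The library's \<open>tree\<close> forbids all directed cycles and therefore never holds of a symmetric
  digraph with at least one edge (\<open>u, v, u\<close> is a directed cycle). In a simple graph, the undirected
  cycles are the directed cycles with at least three arcs.
\<close>

definition simple_tree :: "'a pair_pre_digraph \<Rightarrow> bool" where
  "simple_tree G \<longleftrightarrow> pair_graph G \<and> Digraph_Component.connected (with_proj G)
     \<and> \<not> (\<exists>p. pre_digraph.cycle (with_proj G) p \<and> 3 \<le> length p)"

definition gdist :: "('a, 'b) pre_digraph \<Rightarrow> 'a \<Rightarrow> 'a \<Rightarrow> nat" where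
  "gdist G u v = (LEAST k. \<exists>p. pre_digraph.awalk G u p v \<and> length p = k)"

text \<open>On reachable pairs, this is the library's path metric for unit arc weights.\<close>

lemma (in wf_digraph) mu_unit_eq_gdist:
  assumes "u \<rightarrow>\<^sup>* v"
  shows "\<mu> (\<lambda>_. 1) u v = ereal (real (gdist G u v))"
proof -
  have cost: "awalk_cost (\<lambda>_. 1) p = real (length p)" for p :: "'b awalk"
    by (induction p) (auto simp: awalk_cost_def)
  from assms obtain q where "awalk u q v" by (auto simp: reachable_awalk)
  then have "\<exists>k p. awalk u p v \<and> length p = k" by blast
  then have "\<exists>p. awalk u p v \<and> length p = gdist G u v"
    unfolding gdist_def by (rule LeastI_ex)
  moreover have "gdist G u v \<le> length p" if "awalk u p v" for p
    unfolding gdist_def using that by (intro Least_le) blast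
  ultimately show ?thesis
    unfolding \<mu>_def cost by (intro antisym INF_greatest) (auto intro: INF_lower2)
qed

definition ecc :: "('a, 'b) pre_digraph \<Rightarrow> 'a \<Rightarrow> nat" where
  "ecc G u = Max ((\<lambda>v. gdist G u v) ` verts G)"

definition diam :: "('a, 'b) pre_digraph \<Rightarrow> nat" where
  "diam G = Max ((\<lambda>(u, v). gdist G u v) ` (verts G \<times> verts G))"

definition center :: "('a, 'b) pre_digraph \<Rightarrow> 'a set" where
  "center G = {u \<in> verts G. \<forall>v \<in> verts G. ecc G u \<le> ecc G v}"

definition delete_star :: "'a pair_pre_digraph \<Rightarrow> 'a \<Rightarrow> 'a set \<Rightarrow> 'a pair_pre_digraph" where
  "delete_star G u W = \<lparr> pverts = pverts G, parcs = parcs G - ({u} \<times> W \<union> W \<times> {u}) \<rparr>"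

text \<open>For symmetric digraphs the strong components are the usual connected components.\<close>

definition component_of :: "('a, 'b) pre_digraph \<Rightarrow> 'a \<Rightarrow> ('a, 'b) pre_digraph" where
  "component_of G v = G \<restriction> pre_digraph.scc_of G v"

text \<open>
  The set \<open>U = {u\<^sub>1, \<dots>, u\<^sub>l}\<close> of all neighbours \<open>v\<close> of \<open>u\<^sub>0\<close> such that \<open>v\<close> has eccentricity \<open>k\<close>
  inside its component of the forest obtained by deleting the edges \<open>u\<^sub>0u\<^sub>1, \<dots>, u\<^sub>0u\<^sub>l\<close>. The
  condition mentions \<open>U\<close> itself. For \<open>v \<in> U\<close> we have \<open>insert v U = U\<close>; a neighbour \<open>v \<notin> U\<close> is
  tested with its own edge \<open>u\<^sub>0v\<close> deleted too, so that its component is again the branch at \<open>v\<close>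
  and \<open>U\<close> contains every neighbour with the property.
\<close>

definition deep_neighbours :: "'a pair_pre_digraph \<Rightarrow> 'a \<Rightarrow> nat \<Rightarrow> 'a set \<Rightarrow> bool" where
  "deep_neighbours G u\<^sub>0 k U \<longleftrightarrow>
     U = {v. (u\<^sub>0, v) \<in> parcs G \<and>
             ecc (component_of (with_proj (delete_star G u\<^sub>0 (insert v U))) v) v = k}"

text \<open>The list \<open>vs\<close> enumerates the vertices and fixes the order of rows and columns.\<close>

definition ecc_mat :: "('a, 'b) pre_digraph \<Rightarrow> 'a list \<Rightarrow> real mat" where
  "ecc_mat G vs = mat (length vs) (length vs) (\<lambda>(i, j).
     if gdist G (vs ! i) (vs ! j) = min (ecc G (vs ! i)) (ecc G (vs ! j))
     then real (gdist G (vs ! i) (vs ! j)) else 0)"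

definition inertia :: "real mat \<Rightarrow> nat \<times> nat \<times> nat" where
  "inertia A =
     ((\<Sum>x | eigenvalue A x \<and> x > 0. order x (char_poly A)),
      (\<Sum>x | eigenvalue A x \<and> x < 0. order x (char_poly A)),
      order 0 (char_poly A))"

end

(*
  Root the tree at its center. As two branches at the center reach depth d, every vertex x at
  depth h x has eccentricity d + h x, and the entry of the eccentricity matrix at x, y is
  h x + h y if x and y lie in different branches and one of them has depth d, and 0 otherwise.
  For a branch u in U let s_u(v) be the sum of the coordinates of v at the vertices of depth d in u,
  and let w_u(v) be the sum, over the vertices j outside u, of c_j v_j, where c_j = d if h j = d
  and c_j = d + h j otherwise. The quadratic form of the matrix is then 2 * sum_u s_u w_u, and these
  2l linear functionals are independent, because every branch in U also contains a vertex of depth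
  less than d and the center lies in no branch. Diagonalising the matrix orthogonally and comparing
  with 4 s w = (s + w)^2 - (s - w)^2, as in Sylvester's law of inertia, gives the result.
*)
theory Submission
  imports Defs
begin

section \<open>Spectral theorem for real symmetric matrices\<close>

text \<open>The characteristic polynomial splits over the complex numbers, which gives a complex
  eigenvalue \<open>z\<close>; the Hermitian form evaluated at an eigenvector then forces
  \<open>z\<close> to be real.\<close>

lemma real_symmetric_eigenvector:
  fixes A :: "real mat"
  assumes A: "A \<in> carrier_mat n n" and sym: "transpose_mat A = A" and n: "n > 0"
  obtains v k where "v \<in> carrier_vec n" "v \<bullet> v = 1" "A *\<^sub>v v = k \<cdot>\<^sub>v v"
proof -
  let ?A = "map_mat complex_of_real A"
  have A': "?A \<in> carrier_mat n n" using A by simp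
  obtain as where as: "char_poly ?A = (\<Prod>a\<leftarrow>as. [:- a, 1:])" "length as = n"
    using char_poly_factorized[OF A'] by blast
  obtain z where z: "poly (char_poly ?A) z = 0"
    using as n by (cases as) auto
  then have "eigenvalue ?A z" using eigenvalue_root_char_poly[OF A'] by blast
  then obtain w where w: "w \<in> carrier_vec n" "w \<noteq> 0\<^sub>v n" "?A *\<^sub>v w = z \<cdot>\<^sub>v w"
    unfolding eigenvalue_def eigenvector_def using A by auto
  \<comment> \<open>\<open>L\<close> is the Hermitian form of \<open>A\<close> at \<open>w\<close>,
    and \<open>N\<close> is the squared norm of \<open>w\<close>. Symmetry makes \<open>L\<close>
    its own conjugate, the eigenvector equation gives \<open>L = z * N\<close>, and
    \<open>N > 0\<close> makes \<open>z\<close> real.\<close>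
  define L where "L = (\<Sum>i<n. \<Sum>j<n. cnj (w $ i) * of_real (A $$ (i, j)) * w $ j)"
  define N where "N = (\<Sum>i<n. (cmod (w $ i))\<^sup>2)"
  have symA: "A $$ (i, j) = A $$ (j, i)" if "i < n" "j < n" for i j
    using sym A that by (metis carrier_matD index_transpose_mat(1))
  have "cnj L = (\<Sum>i<n. \<Sum>j<n. w $ i * of_real (A $$ (i, j)) * cnj (w $ j))"
    unfolding L_def by simp
  also have "\<dots> = (\<Sum>j<n. \<Sum>i<n. w $ i * of_real (A $$ (i, j)) * cnj (w $ j))"
    by (rule sum.swap)
  also have "\<dots> = L"
    unfolding L_def by (intro sum.cong refl) (auto simp: symA)
  finally have cL: "cnj L = L" .
  have "(\<Sum>j<n. of_real (A $$ (i, j)) * w $ j) = z * w $ i" if "i < n" for i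
    using arg_cong[OF w(3), of "\<lambda>x. x $ i"] that A w(1)
    by (simp add: scalar_prod_def lessThan_atLeast0)
  then have "L = (\<Sum>i<n. cnj (w $ i) * (z * w $ i))"
    unfolding L_def by (simp add: sum_distrib_left[symmetric] mult.assoc)
  also have "\<dots> = z * of_real N"
    unfolding N_def sum_distrib_left of_real_sum
    by (intro sum.cong refl) (simp add: complex_norm_square mult_ac del: of_real_power)
  finally have L: "L = z * of_real N" .
  obtain i where i: "i < n" "w $ i \<noteq> 0"
    using w(1,2) by (metis eq_vecI carrier_vecD index_zero_vec(1,2))
  have "0 < N" unfolding N_def using i by (intro sum_pos2[of _ i]) auto
  with L cL have "cnj z = z" by auto
  then obtain k where k: "z = of_real k" by (metis Reals_cnj_iff Reals_cases)
  \<comment> \<open>The vector \<open>w\<close> may be genuinely complex, so a real eigenvector is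
    taken anew from the real root \<open>k\<close>.\<close>
  have "poly (char_poly A) k = 0"
    using z unfolding k of_real_hom.char_poly_hom[OF A] by (simp add: of_real_hom.poly_map_poly)
  then have "eigenvalue A k" using eigenvalue_root_char_poly[OF A] by blast
  then obtain x where x: "x \<in> carrier_vec n" "x \<noteq> 0\<^sub>v n" "A *\<^sub>v x = k \<cdot>\<^sub>v x"
    unfolding eigenvalue_def eigenvector_def using A by auto
  let ?s = "1 / sqrt (x \<bullet> x)"
  have pos: "x \<bullet> x > 0"
  proof -
    obtain i where "i < n" "x $ i \<noteq> 0"
      using x(1,2) by (metis eq_vecI carrier_vecD index_zero_vec(1,2))
    then show ?thesis
      using x(1) by (auto simp: scalar_prod_def power2_eq_square[symmetric] intro!: sum_pos2[of _ i])
  qed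
  show thesis
  proof
    show "?s \<cdot>\<^sub>v x \<in> carrier_vec n" using x by simp
    show "(?s \<cdot>\<^sub>v x) \<bullet> (?s \<cdot>\<^sub>v x) = 1" using x pos by (simp add: field_simps)
    show "A *\<^sub>v (?s \<cdot>\<^sub>v x) = k \<cdot>\<^sub>v (?s \<cdot>\<^sub>v x)"
      using A x by (simp add: mult_mat_vec smult_smult_assoc mult.commute)
  qed
qed

text \<open>The reflection in the hyperplane orthogonal to \<open>v - e_0\<close> exchanges the unit
  vectors \<open>v\<close> and \<open>e_0\<close>, and a reflection is symmetric and its own
  inverse. For \<open>v = e_0\<close> the identity serves.\<close>

lemma householder:
  fixes v :: "real vec"
  assumes v: "v \<in> carrier_vec n" and unit: "v \<bullet> v = 1" and n: "n > 0"
  obtains H where "H \<in> carrier_mat n n" "transpose_mat H = H" "H * H = 1\<^sub>m n"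
    "H *\<^sub>v unit_vec n 0 = v"
proof (cases "v = unit_vec n 0")
  case True
  then show thesis using that[of "1\<^sub>m n"] by simp
next
  case False
  define u where "u = v - unit_vec n 0"
  have u: "u \<in> carrier_vec n" unfolding u_def using v by simp
  define N where "N = (\<Sum>k<n. (u $ k)\<^sup>2)"
  define H where "H = mat n n (\<lambda>(i, j). (if i = j then 1 else 0) - 2 / N * u $ i * u $ j)"
  obtain i where i: "i < n" "u $ i \<noteq> 0"
    using False v unfolding u_def
    by (metis (no_types, lifting) carrier_vecD eq_vecI index_minus_vec(1) index_unit_vec(3)
        right_minus_eq)
  have N: "N > 0" unfolding N_def using i by (intro sum_pos2[of _ i]) auto
  have uk: "u $ k = v $ k - (if k = 0 then 1 else 0)" if "k < n" for k
    using that v n by (simp add: u_def unit_vec_def)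
  have sv: "(\<Sum>k<n. (v $ k)\<^sup>2) = 1"
    using unit v by (simp add: scalar_prod_def lessThan_atLeast0 power2_eq_square)
  have "N = (\<Sum>k<n. (v $ k)\<^sup>2 + (if k = 0 then 1 - 2 * v $ k else 0))"
    unfolding N_def by (intro sum.cong refl) (auto simp: uk power2_eq_square algebra_simps)
  also have "\<dots> = 2 - 2 * v $ 0" using n by (simp add: sum.distrib sv sum.delta)
  \<comment> \<open>Both vectors have norm one, so \<open>N\<close> equals
    \<open>2 - 2 * v_0\<close>. This cancels the factor \<open>2 / N\<close> in the first column of
    \<open>H\<close>, which becomes \<open>e_0 + u = v\<close>.\<close>
  finally have N2: "N = - 2 * u $ 0" using uk[OF n] by simp
  have H: "H \<in> carrier_mat n n" by (simp add: H_def)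
  show thesis
  proof
    show "H \<in> carrier_mat n n" by fact
    show "transpose_mat H = H" by (rule eq_matI) (auto simp: H_def)
    show "H * H = 1\<^sub>m n"
    proof (rule eq_matI)
      fix i j assume "i < dim_row (1\<^sub>m n :: real mat)" "j < dim_col (1\<^sub>m n :: real mat)"
      then have ij: "i < n" "j < n" by auto
      have "(H * H) $$ (i, j) = (\<Sum>k<n. H $$ (i, k) * H $$ (k, j))"
        using ij by (simp add: H_def scalar_prod_def lessThan_atLeast0)
      also have "\<dots> = (\<Sum>k<n. (if k = i then if i = j then 1 else 0 else 0)
          - (if k = i then 2 / N * u $ i * u $ j else 0)
          - (if k = j then 2 / N * u $ i * u $ j else 0)
          + (2 / N)\<^sup>2 * u $ i * u $ j * (u $ k)\<^sup>2)"
        using ij by (intro sum.cong refl) (auto simp: H_def power2_eq_square algebra_simps)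
      also have "\<dots> = (if i = j then 1 else 0) - 2 * (2 / N * u $ i * u $ j)
          + (2 / N)\<^sup>2 * u $ i * u $ j * N"
        unfolding sum.distrib sum_subtractf sum_distrib_left[symmetric] N_def[symmetric]
        using ij by simp
      also have "\<dots> = (if i = j then 1 else 0)" using N by (simp add: power2_eq_square)
      finally show "(H * H) $$ (i, j) = 1\<^sub>m n $$ (i, j)" using ij by simp
    qed (auto simp: H_def)
    show "H *\<^sub>v unit_vec n 0 = v"
    proof (rule eq_vecI)
      fix i assume "i < dim_vec v"
      then have i: "i < n" using v by simp
      have "(H *\<^sub>v unit_vec n 0) $ i = H $$ (i, 0)"
        using i n H by simp
      also have "\<dots> = v $ i" using i n N N2 uk[OF i] by (auto simp: H_def divide_simps; simp add: algebra_simps)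
      finally show "(H *\<^sub>v unit_vec n 0) $ i = v $ i" .
    qed (use v H in auto)
  qed
qed

text \<open>Deflation: conjugating by a reflection that sends \<open>e_0\<close> to a unit
  eigenvector clears the first column outside the diagonal, symmetry clears the first row, and the
  induction hypothesis diagonalises the remaining block.\<close>

theorem real_spectral_theorem:
  fixes A :: "real mat"
  assumes "A \<in> carrier_mat n n" and "transpose_mat A = A"
  obtains Q D where "Q \<in> carrier_mat n n" "D \<in> carrier_mat n n" "diagonal_mat D"
    "transpose_mat Q * Q = 1\<^sub>m n" "A = Q * D * transpose_mat Q"
  using assms
proof (induction n arbitrary: A thesis)
  case 0
  show ?case by (rule "0.prems"(1)[of "1\<^sub>m 0" "1\<^sub>m 0"]) (use 0 in \<open>auto simp: diagonal_mat_def\<close>)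
next
  case (Suc n)
  note A = Suc.prems(2) and symA = Suc.prems(3)
  obtain v k where v: "v \<in> carrier_vec (Suc n)" "v \<bullet> v = 1" "A *\<^sub>v v = k \<cdot>\<^sub>v v"
    using real_symmetric_eigenvector[OF A symA] by blast
  obtain H where H: "H \<in> carrier_mat (Suc n) (Suc n)" "transpose_mat H = H" "H * H = 1\<^sub>m (Suc n)"
    "H *\<^sub>v unit_vec (Suc n) 0 = v" using householder[OF v(1,2)] by blast
  define B where "B = H * A * H"
  have B: "B \<in> carrier_mat (Suc n) (Suc n)" using A H by (simp add: B_def)
  have symB: "transpose_mat B = B" unfolding B_def
    using A H symA by (simp add: transpose_mult[of _ "Suc n" "Suc n" _ "Suc n"])
  have Bij: "B $$ (i, j) = B $$ (j, i)" if "i < Suc n" "j < Suc n" for i j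
    using symB B that by (metis carrier_matD index_transpose_mat(1))
  have "B *\<^sub>v unit_vec (Suc n) 0 = H *\<^sub>v (A *\<^sub>v (H *\<^sub>v unit_vec (Suc n) 0))"
    unfolding B_def using A H(1) by (simp add: assoc_mult_mat_vec[of _ "Suc n" "Suc n" _ "Suc n"])
  also have "\<dots> = k \<cdot>\<^sub>v (H *\<^sub>v (H *\<^sub>v unit_vec (Suc n) 0))"
    using H v by (simp add: mult_mat_vec)
  also have "H *\<^sub>v (H *\<^sub>v unit_vec (Suc n) 0) = (H * H) *\<^sub>v unit_vec (Suc n) 0"
    using H(1) by simp
  finally have Be: "B *\<^sub>v unit_vec (Suc n) 0 = k \<cdot>\<^sub>v unit_vec (Suc n) 0" unfolding H(3) by simp
  have B0: "B $$ (i, 0) = (if i = 0 then k else 0)" if "i < Suc n" for i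
    using arg_cong[OF Be, of "\<lambda>x. x $ i"] that B by simp
  define A2 where "A2 = mat n n (\<lambda>(i, j). B $$ (Suc i, Suc j))"
  have A2: "A2 \<in> carrier_mat n n" by (simp add: A2_def)
  have symA2: "transpose_mat A2 = A2" by (rule eq_matI) (auto simp: A2_def Bij)
  let ?k = "mat 1 1 (\<lambda>_. k)"
  have Bblock: "B = four_block_mat ?k (0\<^sub>m 1 n) (0\<^sub>m n 1) A2"
  proof (rule eq_matI)
    fix i j
    assume "i < dim_row (four_block_mat ?k (0\<^sub>m 1 n) (0\<^sub>m n 1) A2)"
      "j < dim_col (four_block_mat ?k (0\<^sub>m 1 n) (0\<^sub>m n 1) A2)"
    then have ij: "i < Suc n" "j < Suc n" by (auto simp: A2_def)
    show "B $$ (i, j) = four_block_mat ?k (0\<^sub>m 1 n) (0\<^sub>m n 1) A2 $$ (i, j)"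
      using ij B0[of i] B0[of j] Bij[of i j] by (cases i; cases j) (auto simp: A2_def)
  qed (use B in \<open>auto simp: A2_def\<close>)
  obtain Q2 D2 where Q2: "Q2 \<in> carrier_mat n n" and D2: "D2 \<in> carrier_mat n n" "diagonal_mat D2"
    and orth2: "transpose_mat Q2 * Q2 = 1\<^sub>m n" and dec2: "A2 = Q2 * D2 * transpose_mat Q2"
    using Suc.IH[OF _ A2 symA2] by blast
  define W where "W = four_block_mat (1\<^sub>m 1) (0\<^sub>m 1 n) (0\<^sub>m n 1) Q2"
  define D where "D = four_block_mat ?k (0\<^sub>m 1 n) (0\<^sub>m n 1) D2"
  have W: "W \<in> carrier_mat (Suc n) (Suc n)" and D: "D \<in> carrier_mat (Suc n) (Suc n)"
    using Q2 D2 four_block_carrier_mat[of _ 1 1 _ n n] by (auto simp: W_def D_def)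
  have WT: "transpose_mat W = four_block_mat (1\<^sub>m 1) (0\<^sub>m 1 n) (0\<^sub>m n 1) (transpose_mat Q2)"
    unfolding W_def using Q2 by (subst transpose_four_block_mat[of _ 1 1 _ n _ n]) auto
  have WW: "transpose_mat W * W = 1\<^sub>m (Suc n)"
    unfolding WT unfolding W_def using Q2 orth2
    by (subst mult_four_block_mat[of _ 1 1 _ n _ n _ _ 1 _ n])
       (auto simp: four_block_one_mat[of 1 n, simplified])
  have "W * D = four_block_mat ?k (0\<^sub>m 1 n) (0\<^sub>m n 1) (Q2 * D2)"
    unfolding W_def D_def using Q2 D2
    by (subst mult_four_block_mat[of _ 1 1 _ n _ n _ _ 1 _ n]) auto
  then have "W * D * transpose_mat W
      = four_block_mat ?k (0\<^sub>m 1 n) (0\<^sub>m n 1) (Q2 * D2 * transpose_mat Q2)"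
    unfolding WT using Q2 D2 by (simp, subst mult_four_block_mat[of _ 1 1 _ n _ n _ _ 1 _ n]) auto
  then have WDW: "W * D * transpose_mat W = B" using Bblock dec2 by simp
  have diagD: "diagonal_mat D"
    using D2 by (auto simp: diagonal_mat_def D_def)
  have HBH: "H * B * H = A"
  proof -
    have "H * B * H = (H * H) * A * (H * H)" using A H(1)
      by (simp add: B_def assoc_mult_mat[of _ "Suc n" "Suc n" _ "Suc n" _ "Suc n"])
    then show ?thesis using A unfolding H(3) by simp
  qed
  \<comment> \<open>Since \<open>W\<close> diagonalises \<open>B\<close> and
    \<open>A = H * B * H\<close>, the product \<open>H * W\<close> diagonalises
    \<open>A\<close>.\<close>
  let ?Q = "H * W"
  have QT: "transpose_mat ?Q = transpose_mat W * H"
    using H(1,2) W by (simp add: transpose_mult[of _ "Suc n" "Suc n" _ "Suc n"])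
  show ?case
  proof (rule Suc.prems(1))
    show "?Q \<in> carrier_mat (Suc n) (Suc n)" using H W by simp
    show "D \<in> carrier_mat (Suc n) (Suc n)" "diagonal_mat D" by fact+
    have "transpose_mat ?Q * ?Q = transpose_mat W * (H * H) * W"
      unfolding QT using H(1) W
      by (simp add: assoc_mult_mat[of _ "Suc n" "Suc n" _ "Suc n" _ "Suc n"])
    then show "transpose_mat ?Q * ?Q = 1\<^sub>m (Suc n)"
      unfolding H(3) using W WW by simp
    have "?Q * D * transpose_mat ?Q = H * (W * D * transpose_mat W) * H"
      unfolding QT using H(1) W D
      by (simp add: assoc_mult_mat[of _ "Suc n" "Suc n" _ "Suc n" _ "Suc n"])
    then show "A = ?Q * D * transpose_mat ?Q" unfolding WDW HBH ..
  qed
qed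

section \<open>Inertia of a quadratic form\<close>

text \<open>Gaussian elimination, by induction on the equations: each one uses up at most one
  variable.\<close>

lemma homogeneous_system_nontrivial:
  fixes a :: "'i \<Rightarrow> 'j \<Rightarrow> 'f::field"
  assumes "finite I" and "finite J" and "card I < card J"
  obtains x where "\<exists>j\<in>J. x j \<noteq> 0" and "\<forall>i\<in>I. (\<Sum>j\<in>J. a i j * x j) = 0"
  using assms
proof (induction I arbitrary: J a thesis rule: finite_induct)
  case empty
  then have "J \<noteq> {}" by auto
  then show ?case by (intro empty(1)[of "\<lambda>_. 1"]) auto
next
  case (insert i I)
  show ?case
  proof (cases "\<forall>j\<in>J. a i j = 0")
    case True
    obtain x where "\<exists>j\<in>J. x j \<noteq> 0" "\<forall>i\<in>I. (\<Sum>j\<in>J. a i j * x j) = 0"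
      using insert.IH[of J a] insert by auto
    with True show ?thesis by (intro insert.prems(1)[of x]) auto
  next
    case False
    then obtain k where k: "k \<in> J" "a i k \<noteq> 0" by blast
    let ?J = "J - {k}"
    \<comment> \<open>\<open>a'\<close> is the system left after equation \<open>i\<close> has been
      solved for the pivot variable at \<open>k\<close> and substituted into the others;
      \<open>t\<close> below is the value recovered for the pivot.\<close>
    define a' where "a' i' j = a i' j - a i' k * a i j / a i k" for i' j
    have "card I < card ?J" using insert k by simp
    then obtain x where x: "\<exists>j\<in>?J. x j \<noteq> 0" "\<forall>i\<in>I. (\<Sum>j\<in>?J. a' i j * x j) = 0"
      using insert.IH[of ?J a'] insert.prems by blast
    define t where "t = - (\<Sum>j\<in>?J. a i j * x j) / a i k"
    define y where "y = x(k := t)"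
    have split: "(\<Sum>j\<in>J. a i' j * y j) = a i' k * t + (\<Sum>j\<in>?J. a i' j * x j)" for i'
      using k insert.prems(2) by (subst sum.remove[of _ k]) (auto simp: y_def intro!: sum.cong)
    show ?thesis
    proof (rule insert.prems(1))
      show "\<exists>j\<in>J. y j \<noteq> 0" using x(1) by (auto simp: y_def)
      show "\<forall>i'\<in>insert i I. (\<Sum>j\<in>J. a i' j * y j) = 0"
      proof
        fix i' assume "i' \<in> insert i I"
        then consider "i' = i" | "i' \<in> I" by blast
        then show "(\<Sum>j\<in>J. a i' j * y j) = 0"
        proof cases
          case 1
          then show ?thesis unfolding split using k by (simp add: t_def)
        next
          case 2
          then have "0 = (\<Sum>j\<in>?J. a' i' j * x j)" using x(2) by simp
          also have "\<dots> = (\<Sum>j\<in>?J. a i' j * x j) - a i' k / a i k * (\<Sum>j\<in>?J. a i j * x j)"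
            unfolding a'_def sum_distrib_left sum_subtractf[symmetric]
            by (intro sum.cong refl) (simp add: algebra_simps)
          finally show ?thesis unfolding split t_def by (simp add: algebra_simps)
        qed
      qed
    qed
  qed
qed

text \<open>The dimension count behind Sylvester's law. With more positive \<open>ds i\<close> than
  elements of \<open>U\<close>, the equations from the nonpositive \<open>ds i\<close> and from
  \<open>U\<close> number fewer than \<open>n\<close>. They have a common nonzero solution, at which
  \<open>q\<close> would be both positive and at most zero.\<close>

lemma pos_index_le:
  fixes C :: "nat \<Rightarrow> nat \<Rightarrow> real" and q :: "(nat \<Rightarrow> real) \<Rightarrow> real"
  assumes q: "\<And>v. q v = (\<Sum>i<n. ds i * (\<Sum>j<n. C i j * v j)\<^sup>2)"
    and inj: "\<And>v. \<forall>i<n. (\<Sum>j<n. C i j * v j) = 0 \<Longrightarrow> \<forall>j<n. v j = 0"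
    and U: "finite U"
    and neg: "\<And>v. \<forall>u\<in>U. (\<Sum>j<n. F u j * v j) = 0 \<Longrightarrow> q v \<le> 0"
  shows "card {i. i < n \<and> ds i > 0} \<le> card U"
proof (rule ccontr)
  assume contr: "\<not> ?thesis"
  let ?N = "{i. i < n \<and> ds i \<le> 0}" and ?P = "{i. i < n \<and> ds i > 0}"
  have "?N \<union> ?P = {..<n}" by auto
  then have "card ?N + card ?P = card {..<n}"
    by (metis (no_types, lifting) card_Un_disjoint disjoint_iff finite_Un finite_lessThan
        mem_Collect_eq not_le)
  \<comment> \<open>The disjoint sum \<open>?N <+> U\<close> indexes both kinds of equation in one
    linear system.\<close>
  then have "card (?N <+> U) < card {..<n}" using contr U by (simp add: card_Plus)
  then obtain v where v: "\<exists>j\<in>{..<n}. v j \<noteq> 0"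
    and 0: "\<forall>k\<in>?N <+> U. (\<Sum>j<n. (case k of Inl i \<Rightarrow> C i j | Inr u \<Rightarrow> F u j) * v j) = 0"
    using homogeneous_system_nontrivial[of "?N <+> U" "{..<n}"
        "\<lambda>k j. case k of Inl i \<Rightarrow> C i j | Inr u \<Rightarrow> F u j"] U by auto
  have C0: "(\<Sum>j<n. C i j * v j) = 0" if "i < n" "ds i \<le> 0" for i
    using bspec[OF 0, of "Inl i"] that by auto
  have "q v \<le> 0" using bspec[OF 0, of "Inr _"] by (intro neg) auto
  moreover have "q v > 0"
  proof -
    obtain i where i: "i < n" "(\<Sum>j<n. C i j * v j) \<noteq> 0" using inj v by blast
    have "0 \<le> ds j * (\<Sum>k<n. C j k * v k)\<^sup>2" if "j < n" for j
      using C0[OF that] by (cases "ds j \<le> 0") auto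
    moreover have "0 < ds i * (\<Sum>k<n. C i k * v k)\<^sup>2"
      using C0[of i] i by (cases "ds i \<le> 0") auto
    ultimately show ?thesis unfolding q using i(1) by (intro sum_pos2[of _ i]) auto
  qed
  ultimately show False by simp
qed

text \<open>The opposite half: \<open>pos\<close> makes \<open>q\<close> positive definite in the
  parameters \<open>x\<close>. With fewer positive \<open>ds i\<close> than parameters, some nonzero
  \<open>x\<close> would annihilate every square with positive coefficient and give
  \<open>q \<le> 0\<close>.\<close>

lemma pos_index_ge:
  fixes C :: "nat \<Rightarrow> nat \<Rightarrow> real" and q :: "(nat \<Rightarrow> real) \<Rightarrow> real"
  assumes q: "\<And>v. q v = (\<Sum>i<n. ds i * (\<Sum>j<n. C i j * v j)\<^sup>2)"
    and U: "finite U"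
    and pos: "\<And>x. \<exists>u\<in>U. x u \<noteq> 0 \<Longrightarrow> q (\<lambda>j. \<Sum>u\<in>U. \<alpha> u j * x u) > 0"
  shows "card U \<le> card {i. i < n \<and> ds i > 0}"
proof (rule ccontr)
  let ?P = "{i. i < n \<and> ds i > 0}"
  assume "\<not> ?thesis"
  then obtain x where x: "\<exists>u\<in>U. x u \<noteq> 0"
    and 0: "\<forall>i\<in>?P. (\<Sum>u\<in>U. (\<Sum>j<n. C i j * \<alpha> u j) * x u) = 0"
    using homogeneous_system_nontrivial[of ?P U "\<lambda>i u. \<Sum>j<n. C i j * \<alpha> u j"] U by auto
  let ?v = "\<lambda>j. \<Sum>u\<in>U. \<alpha> u j * x u"
  have "(\<Sum>j<n. C i j * ?v j) = (\<Sum>u\<in>U. (\<Sum>j<n. C i j * \<alpha> u j) * x u)" for i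
    unfolding sum_distrib_left sum_distrib_right
    by (subst sum.swap) (simp add: mult.assoc)
  then have "(\<Sum>j<n. C i j * ?v j) = 0" if "i < n" "ds i > 0" for i
    using 0 that by simp
  then have "ds i * (\<Sum>j<n. C i j * ?v j)\<^sup>2 \<le> 0" if "i < n" for i
    using that by (cases "ds i > 0") (auto intro: mult_nonpos_nonneg)
  then have "q ?v \<le> 0" unfolding q by (intro sum_nonpos) simp
  with pos[OF x] show False by simp
qed

section \<open>Signs and multiplicities of eigenvalues from a split characteristic
  polynomial\<close>

lemma order_prod_linear:
  fixes ds :: "'i \<Rightarrow> 'f::field"
  assumes "finite I"
  shows "order x (\<Prod>i\<in>I. [:- ds i, 1:]) = card {i\<in>I. ds i = x}"
  using assms
proof (induction I rule: finite_induct)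
  case empty
  then show ?case by (simp add: order_0I)
next
  case (insert i I)
  have "order x [:- ds i, 1:] = (if ds i = x then 1 else 0)"
    using order_power_n_n[of "ds i" 1] by (auto intro: order_0I)
  moreover have "(\<Prod>i\<in>I. [:- ds i, 1:]) \<noteq> 0" using insert by simp
  moreover have "{j \<in> insert i I. ds j = x} = (if ds i = x then insert i {j\<in>I. ds j = x} else {j\<in>I. ds j = x})"
    by auto
  moreover have "[:- ds i, 1:] * (\<Prod>i\<in>I. [:- ds i, 1:]) \<noteq> 0"
    using insert by (simp del: mult_pCons_left)
  ultimately show ?case using insert by (simp add: order_mult del: mult_pCons_left)
qed

text \<open>\<open>inertia\<close> sums multiplicities over distinct eigenvalues. These are the
  sizes of the fibres of \<open>ds\<close>, and the fibres over values of one sign partition the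
  indices with that sign.\<close>

lemma inertia_eq_card:
  fixes A :: "real mat"
  assumes A: "A \<in> carrier_mat n n" and cp: "char_poly A = (\<Prod>i<n. [:- ds i, 1:])"
  shows "inertia A = (card {i. i < n \<and> ds i > 0}, card {i. i < n \<and> ds i < 0}, card {i. i < n \<and> ds i = 0})"
proof -
  have ord: "order x (char_poly A) = card {i. i < n \<and> ds i = x}" for x
    unfolding cp by (subst order_prod_linear) auto
  have ev: "eigenvalue A x \<longleftrightarrow> (\<exists>i<n. ds i = x)" for x
    unfolding eigenvalue_root_char_poly[OF A] cp poly_prod by (auto simp: prod_zero_iff)
  have "(\<Sum>x | eigenvalue A x \<and> P x. order x (char_poly A)) = card {i. i < n \<and> P (ds i)}" for P
  proof -
    have "{x. eigenvalue A x \<and> P x} = ds ` {i. i < n \<and> P (ds i)}" by (auto simp: ev)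
    then have "(\<Sum>x | eigenvalue A x \<and> P x. order x (char_poly A))
        = (\<Sum>x\<in>ds ` {i. i < n \<and> P (ds i)}. card {i. i < n \<and> ds i = x})"
      by (simp add: ord)
    also have "\<dots> = card (\<Union>x\<in>ds ` {i. i < n \<and> P (ds i)}. {i. i < n \<and> ds i = x})"
      by (rule card_UN_disjoint[symmetric]) auto
    also have "(\<Union>x\<in>ds ` {i. i < n \<and> P (ds i)}. {i. i < n \<and> ds i = x}) = {i. i < n \<and> P (ds i)}"
      by auto
    finally show ?thesis .
  qed
  note this[of "\<lambda>x. x > 0"] this[of "\<lambda>x. x < 0"]
  then show ?thesis by (simp add: inertia_def ord)
qed

text \<open>\<open>ds\<close> lists the eigenvalues and \<open>C\<close> is the transpose of the
  orthogonal matrix \<open>Q\<close>, so the inner sums are the coordinates of \<open>v\<close> in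
  an eigenbasis; they determine \<open>v\<close> because \<open>Q\<close> is invertible.\<close>

lemma symmetric_diagonal_form:
  fixes A :: "real mat"
  assumes A: "A \<in> carrier_mat n n" and sym: "transpose_mat A = A"
  obtains C ds where "char_poly A = (\<Prod>i<n. [:- ds i, 1:])"
    and "\<And>v. (\<Sum>i<n. \<Sum>j<n. A $$ (i, j) * v i * v j) = (\<Sum>i<n. ds i * (\<Sum>j<n. C i j * v j)\<^sup>2)"
    and "\<And>v. \<forall>i<n. (\<Sum>j<n. C i j * v j) = 0 \<Longrightarrow> \<forall>j<n. v j = 0"
proof -
  obtain Q D where Q: "Q \<in> carrier_mat n n" and D: "D \<in> carrier_mat n n" "diagonal_mat D"
    and orth: "transpose_mat Q * Q = 1\<^sub>m n" and dec: "A = Q * D * transpose_mat Q"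
    using real_spectral_theorem[OF A sym] by blast
  define ds where "ds i = D $$ (i, i)" for i
  have orth': "Q * transpose_mat Q = 1\<^sub>m n"
    using mat_mult_left_right_inverse[OF _ Q orth] Q by simp
  have "similar_mat A D"
    unfolding similar_mat_def similar_mat_wit_def
    using A Q D dec orth orth' by (intro exI[of _ Q] exI[of _ "transpose_mat Q"]) (auto simp: Let_def)
  then have "char_poly A = char_poly D" by (rule char_poly_similar)
  also have "\<dots> = (\<Prod>a\<leftarrow>diag_mat D. [:- a, 1:])"
    using D by (intro char_poly_upper_triangular[of _ n]) (auto simp: diagonal_mat_def)
  also have "\<dots> = (\<Prod>i<n. [:- ds i, 1:])"
    using D by (simp add: diag_mat_def ds_def o_def prod.list_conv_set_nth lessThan_atLeast0)
  finally have cp: "char_poly A = (\<Prod>i<n. [:- ds i, 1:])" .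
  have QD: "(Q * D) $$ (i, k) = Q $$ (i, k) * ds k" if "i < n" "k < n" for i k
  proof -
    have "(Q * D) $$ (i, k) = (\<Sum>j<n. Q $$ (i, j) * D $$ (j, k))"
      using that Q D by (simp add: scalar_prod_def lessThan_atLeast0)
    also have "\<dots> = (\<Sum>j<n. if j = k then Q $$ (i, k) * ds k else 0)"
      using that D by (intro sum.cong refl) (auto simp: diagonal_mat_def ds_def)
    finally show ?thesis using that by simp
  qed
  have Aij: "A $$ (i, j) = (\<Sum>k<n. ds k * Q $$ (i, k) * Q $$ (j, k))" if "i < n" "j < n" for i j
  proof -
    have "(M * transpose_mat Q) $$ (i, j) = (\<Sum>k<n. M $$ (i, k) * Q $$ (j, k))"
      if "M \<in> carrier_mat n n" for M
      using that \<open>i < n\<close> \<open>j < n\<close> Q by (simp add: scalar_prod_def lessThan_atLeast0)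
    from this[OF mult_carrier_mat[OF Q D(1)]]
    have "A $$ (i, j) = (\<Sum>k<n. (Q * D) $$ (i, k) * Q $$ (j, k))"
      unfolding dec .
    also have "\<dots> = (\<Sum>k<n. ds k * Q $$ (i, k) * Q $$ (j, k))"
      using that by (intro sum.cong refl) (simp add: QD del: index_mult_mat(1))
    finally show ?thesis .
  qed
  show thesis
  proof (rule that[of ds "\<lambda>i j. Q $$ (j, i)"])
    show "char_poly A = (\<Prod>i<n. [:- ds i, 1:])" by fact
  next
    fix v :: "nat \<Rightarrow> real"
    have "(\<Sum>i<n. \<Sum>j<n. A $$ (i, j) * v i * v j)
        = (\<Sum>i<n. \<Sum>j<n. \<Sum>k<n. ds k * ((Q $$ (i, k) * v i) * (Q $$ (j, k) * v j)))"
      by (intro sum.cong refl) (auto simp: Aij sum_distrib_left sum_distrib_right mult_ac)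
    also have "\<dots> = (\<Sum>i<n. \<Sum>k<n. \<Sum>j<n. ds k * ((Q $$ (i, k) * v i) * (Q $$ (j, k) * v j)))"
      by (intro sum.cong refl sum.swap)
    also have "\<dots> = (\<Sum>k<n. \<Sum>i<n. \<Sum>j<n. ds k * ((Q $$ (i, k) * v i) * (Q $$ (j, k) * v j)))"
      by (rule sum.swap)
    also have "\<dots> = (\<Sum>k<n. ds k * (\<Sum>j<n. Q $$ (j, k) * v j)\<^sup>2)"
      unfolding power2_eq_square sum_product by (simp add: sum_distrib_left)
    finally show "(\<Sum>i<n. \<Sum>j<n. A $$ (i, j) * v i * v j) = (\<Sum>k<n. ds k * (\<Sum>j<n. Q $$ (j, k) * v j)\<^sup>2)" .
  next
    fix v :: "nat \<Rightarrow> real"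
    assume 0: "\<forall>i<n. (\<Sum>j<n. Q $$ (j, i) * v j) = 0"
    show "\<forall>j<n. v j = 0"
    proof (intro allI impI)
      fix j assume j: "j < n"
      have "v j = (\<Sum>k<n. (Q * transpose_mat Q) $$ (j, k) * v k)"
        unfolding orth' using j by (simp add: if_distrib[of "\<lambda>x. x * _"] cong: if_cong)
      also have "\<dots> = (\<Sum>k<n. \<Sum>i<n. Q $$ (j, i) * (Q $$ (k, i) * v k))"
        using j Q by (intro sum.cong refl) (auto simp: scalar_prod_def lessThan_atLeast0 sum_distrib_left sum_distrib_right mult_ac)
      also have "\<dots> = (\<Sum>i<n. Q $$ (j, i) * (\<Sum>k<n. Q $$ (k, i) * v k))"
        by (subst sum.swap) (simp add: sum_distrib_left)
      finally show "v j = 0" using 0 by simp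
    qed
  qed
qed

text \<open>The vectors \<alpha> and \<beta> are dual to the functionals \<open>s\<close> and
  \<open>w\<close> and certify their independence. Up to its kernel the form is thus a sum of
  \<open>card U\<close> hyperbolic planes, each with one positive and one negative
  direction.\<close>

theorem inertia_hyperbolic_form:
  fixes A :: "real mat" and s w \<alpha> \<beta> :: "'u \<Rightarrow> nat \<Rightarrow> real"
  assumes A: "A \<in> carrier_mat n n" and sym: "transpose_mat A = A" and U: "finite U"
    and form: "\<And>v. (\<Sum>i<n. \<Sum>j<n. A $$ (i, j) * v i * v j)
      = 2 * (\<Sum>u\<in>U. (\<Sum>j<n. s u j * v j) * (\<Sum>j<n. w u j * v j))"
    and dual: "\<And>u u'. u \<in> U \<Longrightarrow> u' \<in> U \<Longrightarrow> (\<Sum>j<n. s u j * \<alpha> u' j) = of_bool (u = u')"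
      "\<And>u u'. u \<in> U \<Longrightarrow> u' \<in> U \<Longrightarrow> (\<Sum>j<n. w u j * \<alpha> u' j) = 0"
      "\<And>u u'. u \<in> U \<Longrightarrow> u' \<in> U \<Longrightarrow> (\<Sum>j<n. s u j * \<beta> u' j) = 0"
      "\<And>u u'. u \<in> U \<Longrightarrow> u' \<in> U \<Longrightarrow> (\<Sum>j<n. w u j * \<beta> u' j) = of_bool (u = u')"
  shows "inertia A = (card U, card U, n - 2 * card U)"
proof -
  define q where "q v = (\<Sum>i<n. \<Sum>j<n. A $$ (i, j) * v i * v j)" for v
  obtain C ds where cp: "char_poly A = (\<Prod>i<n. [:- ds i, 1:])"
    and dq: "\<And>v. q v = (\<Sum>i<n. ds i * (\<Sum>j<n. C i j * v j)\<^sup>2)"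
    and inj: "\<And>v. \<forall>i<n. (\<Sum>j<n. C i j * v j) = 0 \<Longrightarrow> \<forall>j<n. v j = 0"
    by (rule symmetric_diagonal_form[OF A sym]) (fold q_def, blast)
  have dq': "- q v = (\<Sum>i<n. - ds i * (\<Sum>j<n. C i j * v j)\<^sup>2)" for v
    unfolding dq by (simp add: sum_negf)
  define S W where "S v u = (\<Sum>j<n. s u j * v j)" and "W v u = (\<Sum>j<n. w u j * v j)" for v u
  have \<epsilon>q: "\<epsilon> * q v = 2 * (\<Sum>u\<in>U. S v u * (\<epsilon> * W v u))" for \<epsilon> v
    unfolding q_def form S_def[symmetric] W_def[symmetric]
    by (simp add: sum_distrib_left mult.left_commute)
  \<comment> \<open>Taking \<epsilon> to be 1 or -1 treats \<open>q\<close> and \<open>- q\<close>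
    together. Where \<open>\<epsilon> * W\<close> equals \<open>- S\<close>, the form
    \<open>\<epsilon> * q\<close> is minus twice a sum of squares.\<close>
  have le: "\<epsilon> * q v \<le> 0"
    if \<epsilon>: "\<epsilon> * \<epsilon> = 1" and 0: "\<forall>u\<in>U. (\<Sum>j<n. (s u j + \<epsilon> * w u j) * v j) = 0" for v \<epsilon>
  proof -
    have "\<epsilon> * W v u = - S v u" if "u \<in> U" for u
      using bspec[OF 0 that] unfolding S_def W_def
      by (simp add: distrib_right sum.distrib sum_distrib_left mult.assoc)
    then have "\<epsilon> * q v = 2 * (\<Sum>u\<in>U. - (S v u)\<^sup>2)"
      unfolding \<epsilon>q by (simp add: power2_eq_square)
    then show ?thesis by (simp add: sum_nonneg sum_negf)
  qed
  \<comment> \<open>On the span of the vectors \<open>\<alpha> u + \<epsilon> * \<beta> u\<close>,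
    duality gives \<open>S = x\<close> and \<open>W = \<epsilon> * x\<close>, so
    \<open>\<epsilon> * q\<close> is twice a sum of squares.\<close>
  have gr: "\<epsilon> * q (\<lambda>j. \<Sum>u\<in>U. (\<alpha> u j + \<epsilon> * \<beta> u j) * x u) > 0"
    if \<epsilon>: "\<epsilon> * \<epsilon> = 1" and x: "\<exists>u\<in>U. x u \<noteq> 0" for x \<epsilon>
  proof -
    let ?v = "\<lambda>j. \<Sum>u\<in>U. (\<alpha> u j + \<epsilon> * \<beta> u j) * x u"
    have lin: "(\<Sum>j<n. f j * ?v j)
        = (\<Sum>u\<in>U. ((\<Sum>j<n. f j * \<alpha> u j) + \<epsilon> * (\<Sum>j<n. f j * \<beta> u j)) * x u)" for f :: "nat \<Rightarrow> real"
    proof -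
      have "(\<Sum>j<n. f j * ?v j) = (\<Sum>u\<in>U. \<Sum>j<n. f j * ((\<alpha> u j + \<epsilon> * \<beta> u j) * x u))"
        unfolding sum_distrib_left by (rule sum.swap)
      then show ?thesis
        by (simp add: sum_distrib_left sum_distrib_right sum.distrib algebra_simps)
    qed
    have SW: "S ?v u = x u" "W ?v u = \<epsilon> * x u" if u: "u \<in> U" for u
    proof -
      have "S ?v u = (\<Sum>u'\<in>U. if u = u' then x u' else 0)"
        unfolding S_def lin by (intro sum.cong refl) (auto simp: dual u)
      then show "S ?v u = x u" using u U by simp
      have "W ?v u = (\<Sum>u'\<in>U. if u = u' then \<epsilon> * x u' else 0)"
        unfolding W_def lin by (intro sum.cong refl) (auto simp: dual u)
      then show "W ?v u = \<epsilon> * x u" using u U by simp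
    qed
    have "\<epsilon> * q ?v = 2 * (\<Sum>u\<in>U. x u * (\<epsilon> * (\<epsilon> * x u)))"
      unfolding \<epsilon>q by (simp add: SW)
    also have "\<dots> = 2 * (\<Sum>u\<in>U. (x u)\<^sup>2)"
      using \<epsilon> by (simp add: mult.assoc[symmetric, of \<epsilon> \<epsilon>] power2_eq_square)
    also have "\<dots> > 0"
    proof -
      obtain u where "u \<in> U" "x u \<noteq> 0" using x by blast
      then have "0 < (\<Sum>u\<in>U. (x u)\<^sup>2)" using U by (intro sum_pos2[of _ u]) auto
      then show ?thesis by simp
    qed
    finally show ?thesis .
  qed
  have "card {i. i < n \<and> ds i > 0} \<le> card U"
    by (rule pos_index_le[OF dq inj U, of "\<lambda>u j. s u j + 1 * w u j"]) (use le[of 1] in simp_all)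
  moreover have "card {i. i < n \<and> - ds i > 0} \<le> card U"
    by (rule pos_index_le[OF dq' inj U, of "\<lambda>u j. s u j + (-1) * w u j"]) (use le[of "-1"] in simp_all)
  moreover have "card U \<le> card {i. i < n \<and> ds i > 0}"
    by (rule pos_index_ge[OF dq U, of "\<lambda>u j. \<alpha> u j + 1 * \<beta> u j"]) (use gr[of 1] in simp)
  moreover have "card U \<le> card {i. i < n \<and> - ds i > 0}"
    by (rule pos_index_ge[OF dq' U, of "\<lambda>u j. \<alpha> u j + (-1) * \<beta> u j"]) (use gr[of "-1"] in simp)
  \<comment> \<open>The total count turns the two indices into the number of zero
    eigenvalues.\<close>
  moreover have "card {i. i < n \<and> ds i > 0} + card {i. i < n \<and> ds i < 0}
      + card {i. i < n \<and> ds i = 0} = n"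
  proof -
    let ?P = "{i. i < n \<and> ds i > 0}" and ?N = "{i. i < n \<and> ds i < 0}"
      and ?Z = "{i. i < n \<and> ds i = 0}"
    have "card ?P + card ?N + card ?Z = card (?P \<union> ?N) + card ?Z"
      by (subst card_Un_disjoint) auto
    also have "\<dots> = card (?P \<union> ?N \<union> ?Z)" by (subst card_Un_disjoint) auto
    also have "?P \<union> ?N \<union> ?Z = {..<n}" by auto
    finally show ?thesis by simp
  qed
  ultimately show ?thesis
    unfolding inertia_eq_card[OF A cp] neg_0_less_iff_less prod.inject by (intro conjI; linarith)
qed

text \<open>The tree enters only through the depth \<open>h\<close> and the branch \<open>b\<close>
  of each index. The root \<open>r\<close>, together with one deep and one shallow vertex per branch
  in \<open>U\<close>, supplies the dual vectors for the hyperbolic form.\<close>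

lemma inertia_branch_matrix:
  fixes h :: "nat \<Rightarrow> nat" and b :: "nat \<Rightarrow> 'u" and U :: "'u set"
  assumes U: "finite U" and r: "r < n" "h r = 0" "b r \<notin> U" and d: "d > 0"
    and deep_in: "\<And>j. j < n \<Longrightarrow> h j = d \<Longrightarrow> b j \<in> U"
    and deep: "\<And>u. u \<in> U \<Longrightarrow> \<exists>j<n. h j = d \<and> b j = u"
    and shallow: "\<And>u. u \<in> U \<Longrightarrow> \<exists>j<n. h j \<noteq> d \<and> b j = u"
  shows "inertia (mat n n (\<lambda>(i, j). if (h i = d \<or> h j = d) \<and> b i \<noteq> b j
    then real (h i + h j) else 0)) = (card U, card U, n - 2 * card U)" (is "inertia ?E = _")
proof -
  obtain D where D: "\<And>u. u \<in> U \<Longrightarrow> D u < n \<and> h (D u) = d \<and> b (D u) = u"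
    using deep by metis
  obtain \<sigma> where \<sigma>: "\<And>u. u \<in> U \<Longrightarrow> \<sigma> u < n \<and> h (\<sigma> u) \<noteq> d \<and> b (\<sigma> u) = u"
    using shallow by metis
  \<comment> \<open>A pair of deep vertices in different branches has entry \<open>2 * d\<close> and
    is met from both sides, so each side contributes \<open>d\<close>; any other nonzero entry is
    met only from its deep side, which carries all of \<open>d + h j\<close>.\<close>
  define c :: "nat \<Rightarrow> real" where "c j = (if h j = d then real d else real (d + h j))" for j
  have c: "c j \<noteq> 0" for j using d by (simp add: c_def)
  have cD: "c (D u) = d" if "u \<in> U" for u using D[OF that] by (simp add: c_def)
  have cr: "c r = d" using r d by (simp add: c_def)
  have pick: "(\<Sum>j<n. f j * of_bool (j = k)) = f k" if "k < n" for f :: "nat \<Rightarrow> real" and k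
    using that by (simp add: of_bool_def if_distrib[of "\<lambda>x. _ * x"] cong: if_cong)
  define s :: "'u \<Rightarrow> nat \<Rightarrow> real" where "s u j = of_bool (h j = d \<and> b j = u)" for u j
  define w :: "'u \<Rightarrow> nat \<Rightarrow> real" where "w u j = of_bool (b j \<noteq> u) * c j" for u j
  \<comment> \<open>Only \<open>D u\<close> is visible to \<open>s\<close>. The functional
    \<open>w u'\<close> with \<open>u' \<noteq> u\<close> sees both \<open>D u\<close> and \<sigma>
    \<open>u\<close>, with weights \<open>d\<close> and \<open>c (\<sigma> u)\<close>, and the
    coefficient makes them cancel; \<open>w u\<close> sees neither.\<close>
  define \<alpha> :: "'u \<Rightarrow> nat \<Rightarrow> real"
    where "\<alpha> u j = of_bool (j = D u) - d / c (\<sigma> u) * of_bool (j = \<sigma> u)" for u j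
  \<comment> \<open>Both vertices are shallow, so \<open>s\<close> vanishes. Each \<open>w\<close>
    sees the root with weight \<open>d\<close>, giving 1, and all but \<open>w u\<close> also see
    \<sigma> \<open>u\<close>, which takes the 1 away again.\<close>
  define \<beta> :: "'u \<Rightarrow> nat \<Rightarrow> real"
    where "\<beta> u j = 1 / d * of_bool (j = r) - 1 / c (\<sigma> u) * of_bool (j = \<sigma> u)" for u j
  have sum_\<alpha>: "(\<Sum>j<n. f j * \<alpha> u j) = f (D u) - d / c (\<sigma> u) * f (\<sigma> u)"
    if "u \<in> U" for f u
  proof -
    have "(\<Sum>j<n. f j * \<alpha> u j)
        = (\<Sum>j<n. f j * of_bool (j = D u)) - d / c (\<sigma> u) * (\<Sum>j<n. f j * of_bool (j = \<sigma> u))"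
      unfolding \<alpha>_def sum_distrib_left sum_subtractf[symmetric]
      by (intro sum.cong refl) (simp add: algebra_simps)
    then show ?thesis using D[OF that] \<sigma>[OF that] by (simp add: pick)
  qed
  have sum_\<beta>: "(\<Sum>j<n. f j * \<beta> u j) = 1 / d * f r - 1 / c (\<sigma> u) * f (\<sigma> u)"
    if "u \<in> U" for f u
  proof -
    have "(\<Sum>j<n. f j * \<beta> u j) = 1 / d * (\<Sum>j<n. f j * of_bool (j = r))
        - 1 / c (\<sigma> u) * (\<Sum>j<n. f j * of_bool (j = \<sigma> u))"
      unfolding \<beta>_def sum_distrib_left sum_subtractf[symmetric]
      by (intro sum.cong refl) (simp add: algebra_simps)
    then show ?thesis using r \<sigma>[OF that] by (simp add: pick)
  qed
  show ?thesis
  proof (rule inertia_hyperbolic_form[where s = s and w = w and \<alpha> = \<alpha> and \<beta> = \<beta>])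
    show "?E \<in> carrier_mat n n" by simp
    show "transpose_mat ?E = ?E" by (rule eq_matI) auto
    show "finite U" by fact
  next
    fix u u' assume u: "u \<in> U" "u' \<in> U"
    show "(\<Sum>j<n. s u j * \<alpha> u' j) = of_bool (u = u')"
      using u D[of u'] \<sigma>[of u'] unfolding sum_\<alpha>[OF u(2)] by (auto simp: s_def)
    show "(\<Sum>j<n. w u j * \<alpha> u' j) = 0"
      using u D[of u'] \<sigma>[of u'] c[of "\<sigma> u'"] cD[of u'] unfolding sum_\<alpha>[OF u(2)]
      by (auto simp: w_def)
    show "(\<Sum>j<n. s u j * \<beta> u' j) = 0"
      using u r d \<sigma>[of u'] unfolding sum_\<beta>[OF u(2)] by (auto simp: s_def)
    show "(\<Sum>j<n. w u j * \<beta> u' j) = of_bool (u = u')"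
      using u r d \<sigma>[of u'] c[of "\<sigma> u'"] cr unfolding sum_\<beta>[OF u(2)]
      by (auto simp: w_def)
  next
    fix v :: "nat \<Rightarrow> real"
    \<comment> \<open>\<open>a\<close> is the part of the matrix met from the deep row index; the
      matrix is \<open>a\<close> plus its transpose, which produces the factor 2.\<close>
    define a :: "nat \<Rightarrow> nat \<Rightarrow> real" where "a i j = of_bool (h i = d \<and> b i \<noteq> b j) * c j" for i j
    have "(\<Sum>i<n. \<Sum>j<n. ?E $$ (i, j) * v i * v j)
        = (\<Sum>i<n. \<Sum>j<n. a i j * v i * v j + a j i * v j * v i)"
      by (intro sum.cong refl) (auto simp: a_def c_def algebra_simps)
    also have "\<dots> = (\<Sum>i<n. \<Sum>j<n. a i j * v i * v j) + (\<Sum>i<n. \<Sum>j<n. a j i * v j * v i)"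
      by (simp add: sum.distrib)
    also have "(\<Sum>i<n. \<Sum>j<n. a j i * v j * v i) = (\<Sum>i<n. \<Sum>j<n. a i j * v i * v j)"
      by (rule sum.swap)
    \<comment> \<open>A deep index \<open>i\<close> has its branch in \<open>U\<close>, so exactly
      one summand over \<open>U\<close> survives, the one at \<open>b i\<close>.\<close>
    also have "(\<Sum>i<n. \<Sum>j<n. a i j * v i * v j)
        = (\<Sum>i<n. \<Sum>u\<in>U. s u i * v i * (\<Sum>j<n. w u j * v j))"
    proof (intro sum.cong refl)
      fix i assume "i \<in> {..<n}"
      then have i: "i < n" by simp
      show "(\<Sum>j<n. a i j * v i * v j) = (\<Sum>u\<in>U. s u i * v i * (\<Sum>j<n. w u j * v j))"
      proof (cases "h i = d")
        case True
        have "(\<Sum>u\<in>U. s u i * v i * (\<Sum>j<n. w u j * v j))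
            = (\<Sum>u\<in>U. if u = b i then v i * (\<Sum>j<n. w u j * v j) else 0)"
          using True by (intro sum.cong refl) (auto simp: s_def)
        also have "\<dots> = v i * (\<Sum>j<n. w (b i) j * v j)"
          using U deep_in[OF i True] by simp
        also have "\<dots> = (\<Sum>j<n. a i j * v i * v j)"
          unfolding sum_distrib_left using True
          by (intro sum.cong refl) (auto simp: a_def w_def)
        finally show ?thesis ..
      qed (simp add: a_def s_def)
    qed
    also have "\<dots> = (\<Sum>u\<in>U. (\<Sum>j<n. s u j * v j) * (\<Sum>j<n. w u j * v j))"
      by (subst sum.swap) (simp add: sum_distrib_right)
    finally show "(\<Sum>i<n. \<Sum>j<n. ?E $$ (i, j) * v i * v j)
        = 2 * (\<Sum>u\<in>U. (\<Sum>j<n. s u j * v j) * (\<Sum>j<n. w u j * v j))"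
      by simp
  qed
qed

section \<open>Branches and distances in a tree\<close>

text \<open>Acyclicity is stated locally: a walk between two distinct neighbours of \<open>r\<close>
  must visit \<open>r\<close>. This is the form that makes the branches at \<open>r\<close> well
  defined.\<close>

locale tree_relation =
  fixes V :: "'a set" and A :: "'a rel"
  assumes finite_V: "finite V" and A_sub: "A \<subseteq> V \<times> V" and sym_A: "sym A"
    and irrefl_A: "(x, x) \<notin> A"
    and connected_A: "x \<in> V \<Longrightarrow> y \<in> V \<Longrightarrow> (x, y) \<in> A\<^sup>*"
    and acyclic_A: "(r, u) \<in> A \<Longrightarrow> (r, u') \<in> A
      \<Longrightarrow> (u, u') \<in> {(x, y) \<in> A. x \<noteq> r \<and> y \<noteq> r}\<^sup>* \<Longrightarrow> u = u'"
begin

definition dst :: "'a \<Rightarrow> 'a \<Rightarrow> nat" where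
  "dst x y = (LEAST k. (x, y) \<in> A ^^ k)"

definition avoid :: "'a \<Rightarrow> 'a rel" where
  "avoid r = {(x, y) \<in> A. x \<noteq> r \<and> y \<noteq> r}"

text \<open>The neighbour of \<open>r\<close> serves as the name of its branch. The value
  \<open>r\<close> at the root itself keeps the root outside the branch of every neighbour.\<close>

definition branch :: "'a \<Rightarrow> 'a \<Rightarrow> 'a" where
  "branch r x = (if x = r then r else SOME u. (r, u) \<in> A \<and> (u, x) \<in> (avoid r)\<^sup>*)"

lemma A_symD: "(x, y) \<in> A \<Longrightarrow> (y, x) \<in> A"
  using sym_A by (rule symD)

lemma A_in_V: "(x, y) \<in> A \<Longrightarrow> x \<in> V" "(x, y) \<in> A \<Longrightarrow> y \<in> V"
  using A_sub by auto

lemma relpow_symD: "(x, y) \<in> A ^^ k \<Longrightarrow> (y, x) \<in> A ^^ k"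
proof (induction k arbitrary: y)
  case (Suc k)
  then obtain z where "(x, z) \<in> A ^^ k" "(z, y) \<in> A" by auto
  then show ?case using Suc.IH A_symD relpow_Suc_I2 by metis
qed simp

lemma relpow_dst: "x \<in> V \<Longrightarrow> y \<in> V \<Longrightarrow> (x, y) \<in> A ^^ dst x y"
  unfolding dst_def using connected_A rtrancl_power by (metis LeastI_ex)

lemma dst_le: "(x, y) \<in> A ^^ k \<Longrightarrow> dst x y \<le> k"
  unfolding dst_def by (rule Least_le)

lemma dst_self [simp]: "dst x x = 0"
  using dst_le[of x x 0] by simp

lemma dst_commute: "dst x y = dst y x"
  unfolding dst_def by (metis relpow_symD)

lemma dst_triangle:
  assumes "x \<in> V" "y \<in> V" "z \<in> V"
  shows "dst x z \<le> dst x y + dst y z"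
  using relpow_dst assms by (intro dst_le) (auto simp: relpow_add)

lemma dst_adjacent: "(x, y) \<in> A \<Longrightarrow> dst x y = 1"
proof -
  assume xy: "(x, y) \<in> A"
  then have "dst x y \<le> 1" by (intro dst_le) simp
  moreover have "dst x y \<noteq> 0"
    using relpow_dst[of x y] xy A_in_V irrefl_A by (cases "dst x y") auto
  ultimately show ?thesis by simp
qed

text \<open>A walk that avoids \<open>r\<close> will be confined to one branch; a walk that visits
  \<open>r\<close> is cut there without changing its total length, which gives distance bounds
  through \<open>r\<close>.\<close>

lemma walk_avoids_or_visits:
  assumes "(x, y) \<in> A ^^ k"
  shows "(x, y) \<in> avoid r ^^ k \<and> x \<noteq> r \<and> y \<noteq> r
    \<or> (\<exists>i j. i + j = k \<and> (x, r) \<in> A ^^ i \<and> (r, y) \<in> A ^^ j)"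
  using assms
proof (induction k arbitrary: y)
  case 0
  then show ?case by (cases "x = r") auto
next
  case (Suc k)
  then obtain z where z: "(x, z) \<in> A ^^ k" "(z, y) \<in> A" by auto
  from Suc.IH[OF z(1)] show ?case
  proof
    assume *: "(x, z) \<in> avoid r ^^ k \<and> x \<noteq> r \<and> z \<noteq> r"
    show ?case
    proof (cases "y = r")
      case True
      then show ?thesis using Suc.prems by (intro disjI2 exI[of _ "Suc k"] exI[of _ 0]) auto
    next
      case False
      then show ?thesis using * z(2) by (auto simp: avoid_def)
    qed
  next
    assume "\<exists>i j. i + j = k \<and> (x, r) \<in> A ^^ i \<and> (r, z) \<in> A ^^ j"
    then obtain i j where "i + j = k" "(x, r) \<in> A ^^ i" "(r, z) \<in> A ^^ j" by blast
    then show ?case using z(2) by (intro disjI2 exI[of _ i] exI[of _ "Suc j"]) auto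
  qed
qed

lemma avoid_symD: "(x, y) \<in> (avoid r)\<^sup>* \<Longrightarrow> (y, x) \<in> (avoid r)\<^sup>*"
proof -
  have "sym (avoid r)" using A_symD by (auto simp: avoid_def intro: symI)
  then show "(x, y) \<in> (avoid r)\<^sup>* \<Longrightarrow> (y, x) \<in> (avoid r)\<^sup>*"
    by (meson sym_rtrancl symD)
qed

text \<open>\<open>u\<close> is the second vertex of a shortest walk from \<open>r\<close> to
  \<open>x\<close>. The rest avoids \<open>r\<close>, since a return to \<open>r\<close> would leave
  a shorter walk to \<open>x\<close>.\<close>

lemma first_step:
  assumes V: "r \<in> V" "x \<in> V" and "x \<noteq> r"
  obtains u where "(r, u) \<in> A" "(u, x) \<in> (avoid r)\<^sup>*" "dst r x = Suc (dst u x)"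
proof -
  have "dst r x \<noteq> 0" using relpow_dst[OF V] \<open>x \<noteq> r\<close> by (cases "dst r x") auto
  then obtain k where k: "dst r x = Suc k" by (cases "dst r x") auto
  then obtain u where u: "(r, u) \<in> A" "(u, x) \<in> A ^^ k"
    using relpow_dst[OF V] relpow_Suc_D2 by metis
  have "\<not> (r, x) \<in> A ^^ j" if "j \<le> k" for j
    using dst_le[of r x j] k that by auto
  then have "(u, x) \<in> avoid r ^^ k"
    using walk_avoids_or_visits[OF u(2), of r] by (metis le_add2)
  then have "(u, x) \<in> (avoid r)\<^sup>*" by (rule relpow_imp_rtrancl)
  moreover have "dst u x = k"
    using dst_le[OF u(2)] dst_triangle[of r u x] dst_adjacent[OF u(1)] k V A_in_V u(1) by fastforce
  ultimately show thesis using that u(1) k by simp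
qed

text \<open>Two candidates would be joined through \<open>x\<close> by a walk avoiding
  \<open>r\<close>, so \<open>acyclic_A\<close> makes the choice in \<open>branch\<close>
  unique.\<close>

lemma branch_eqI:
  assumes "(r, u) \<in> A" "(u, x) \<in> (avoid r)\<^sup>*" "x \<noteq> r"
  shows "branch r x = u"
proof -
  have "(r, branch r x) \<in> A \<and> (branch r x, x) \<in> (avoid r)\<^sup>*"
    unfolding branch_def using assms someI[of "\<lambda>u. (r, u) \<in> A \<and> (u, x) \<in> (avoid r)\<^sup>*" u] by simp
  then show ?thesis
    using assms acyclic_A[of r "branch r x" u] avoid_symD unfolding avoid_def
    by (meson rtrancl_trans)
qed

lemma branch_properties:
  assumes "r \<in> V" "x \<in> V" "x \<noteq> r"
  shows "(r, branch r x) \<in> A" "(branch r x, x) \<in> (avoid r)\<^sup>*" "dst r x = Suc (dst (branch r x) x)"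
  using first_step[OF assms] branch_eqI assms(3) by metis+

lemma branch_self [simp]: "branch r r = r"
  by (simp add: branch_def)

lemma branch_eq_root_iff:
  assumes "r \<in> V" "x \<in> V"
  shows "branch r x = r \<longleftrightarrow> x = r"
  using branch_properties(1)[OF assms] irrefl_A branch_self by metis

lemma branch_adjacent: "(r, u) \<in> A \<Longrightarrow> branch r u = u"
  using irrefl_A by (intro branch_eqI) auto

lemma avoid_branch:
  assumes "r \<in> V" "x \<in> V" "x \<noteq> r" "(x, y) \<in> avoid r"
  shows "branch r y = branch r x"
  using branch_properties[OF assms(1-3)] assms(4)
  by (intro branch_eqI) (auto simp: avoid_def intro: rtrancl_into_rtrancl)

lemma avoid_rtrancl_branch:
  assumes "r \<in> V" "x \<in> V" "x \<noteq> r" "(x, y) \<in> (avoid r)\<^sup>*"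
  shows "branch r y = branch r x \<and> y \<in> V \<and> y \<noteq> r"
  using assms(4)
proof (induction rule: rtrancl_induct)
  case (step y z)
  then show ?case using avoid_branch[of r y z] assms(1) A_in_V by (auto simp: avoid_def)
qed (use assms in auto)

text \<open>A walk avoiding \<open>r\<close> cannot change branches, so a shortest walk from
  \<open>x\<close> to \<open>y\<close> passes through \<open>r\<close>.\<close>

lemma dst_distinct_branches:
  assumes V: "r \<in> V" "x \<in> V" "y \<in> V" and ne: "branch r x \<noteq> branch r y"
  shows "dst x y = dst r x + dst r y"
proof -
  consider "(x, y) \<in> avoid r ^^ dst x y" "x \<noteq> r"
    | i j where "i + j = dst x y" "(x, r) \<in> A ^^ i" "(r, y) \<in> A ^^ j"
    using walk_avoids_or_visits[OF relpow_dst[OF V(2,3)], of r] by blast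
  then have "dst r x + dst r y \<le> dst x y"
  proof cases
    case 1
    then show ?thesis
      using avoid_rtrancl_branch[OF V(1,2), of y] ne relpow_imp_rtrancl by metis
  next
    case 2
    then show ?thesis using dst_le[of x r i] dst_le[of r y j] dst_commute[of x r] by simp
  qed
  then show ?thesis using dst_triangle[of x r y] V dst_commute[of x r] by simp
qed

text \<open>The walk may turn round at the common neighbour \<open>branch r x\<close> instead of at
  \<open>r\<close>, which saves the edge between them twice.\<close>

lemma dst_same_branch:
  assumes V: "r \<in> V" "x \<in> V" "y \<in> V" and "x \<noteq> r" and eq: "branch r x = branch r y"
  shows "dst x y + 2 \<le> dst r x + dst r y"
proof -
  have "y \<noteq> r" using assms branch_eq_root_iff by metis
  then show ?thesis
    using branch_properties[OF V(1,2)] branch_properties[OF V(1,3)] assms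
      dst_triangle[of x "branch r x" y] A_in_V dst_commute[of x "branch r x"] by force
qed

lemma exists_vertex_between:
  assumes "dst x y = i + j" "x \<in> V" "y \<in> V"
  obtains m where "m \<in> V" "dst x m = i" "dst m y = j"
proof -
  obtain m where m: "(x, m) \<in> A ^^ i" "(m, y) \<in> A ^^ j"
    using relpow_dst[OF assms(2,3)] unfolding assms(1) by (auto simp: relpow_add)
  have "m \<in> V"
    using m(1) assms(2) A_in_V by (cases i) auto
  then show thesis
    using that[of m] dst_le[OF m(1)] dst_le[OF m(2)] dst_triangle[of x m y] assms by simp
qed

section \<open>Eccentricities and the center\<close>

definition eccentricity :: "'a \<Rightarrow> nat" where
  "eccentricity x = Max (dst x ` V)"

lemma dst_le_eccentricity: "y \<in> V \<Longrightarrow> dst x y \<le> eccentricity x"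
  unfolding eccentricity_def using finite_V by (intro Max_ge) auto

lemma eccentricity_leI:
  assumes "x \<in> V" "\<And>y. y \<in> V \<Longrightarrow> dst x y \<le> k"
  shows "eccentricity x \<le> k"
  unfolding eccentricity_def using finite_V assms by (subst Max_le_iff) auto

text \<open>The midpoint of a diametrical path has every vertex within distance \<open>d\<close>, so
  minimality bounds the eccentricity of \<open>r\<close> by \<open>d\<close>, and the triangle
  inequality for \<open>a\<close> and \<open>c\<close> leaves only equality. In a common branch the
  two ends would be too close.\<close>

lemma eccentricity_center:
  assumes d: "d > 0" and ac: "a \<in> V" "c \<in> V" "dst a c = 2 * d"
    and diam: "\<And>x y. x \<in> V \<Longrightarrow> y \<in> V \<Longrightarrow> dst x y \<le> 2 * d"
    and r: "r \<in> V" and min: "\<And>x. x \<in> V \<Longrightarrow> eccentricity r \<le> eccentricity x"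
  shows "eccentricity r = d" "dst r a = d" "dst r c = d" "branch r a \<noteq> branch r c"
proof -
  obtain m where m: "m \<in> V" "dst a m = d" "dst m c = d"
    using exists_vertex_between[of a c d d] ac by auto
  have ma: "dst m a = d" using m dst_commute[of a m] by simp
  have "branch m a \<noteq> branch m c"
    using dst_same_branch[OF m(1) ac(1,2)] m ma ac(3) d by fastforce
  have "dst m x \<le> d" if x: "x \<in> V" for x
  proof -
    \<comment> \<open>Every \<open>x\<close> lies outside the branch of one of the two ends. The
      walk to that end passes through \<open>m\<close> and has length \<open>dst m x + d\<close>,
      which is at most \<open>2 * d\<close>.\<close>
    from \<open>branch m a \<noteq> branch m c\<close> consider "branch m x \<noteq> branch m a" | "branch m x \<noteq> branch m c"
      by metis
    then show ?thesis
    proof cases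
      case 1
      then show ?thesis
        using dst_distinct_branches[OF m(1) x ac(1)] diam[OF x ac(1)] ma by simp
    next
      case 2
      then show ?thesis
        using dst_distinct_branches[OF m(1) x ac(2)] diam[OF x ac(2)] m by simp
    qed
  qed
  then have "eccentricity m \<le> d" using m by (intro eccentricity_leI) auto
  with min[OF m(1)] have le: "eccentricity r \<le> d" by simp
  have "2 * d \<le> dst r a + dst r c" using dst_triangle[of a r c] ac r dst_commute[of a r] by simp
  then show "eccentricity r = d" "dst r a = d" "dst r c = d"
    using le dst_le_eccentricity[of a r] dst_le_eccentricity[of c r] ac by auto
  then show "branch r a \<noteq> branch r c"
    using dst_same_branch[OF r ac(1,2)] ac(3) d by fastforce
qed

text \<open>One of the deepest vertices \<open>a\<close> and \<open>c\<close> lies outside the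
  branch of \<open>x\<close>, and the walk to it passes through \<open>r\<close>; the triangle
  inequality through \<open>r\<close> gives the upper bound.\<close>

lemma eccentricity_eq_add:
  assumes V: "r \<in> V" "x \<in> V" "a \<in> V" "c \<in> V" and ecc: "eccentricity r = d"
    and deep: "dst r a = d" "dst r c = d" and ne: "branch r a \<noteq> branch r c"
  shows "eccentricity x = d + dst r x"
proof (rule antisym)
  have "dst x y \<le> d + dst r x" if "y \<in> V" for y
    using dst_triangle[of x r y] dst_le_eccentricity[OF that, of r] ecc that V dst_commute[of x r] by simp
  then show "eccentricity x \<le> d + dst r x" using V by (intro eccentricity_leI) auto
  from ne consider "branch r x \<noteq> branch r a" | "branch r x \<noteq> branch r c" by metis
  then show "d + dst r x \<le> eccentricity x"
  proof cases
    case 1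
    then show ?thesis
      using dst_distinct_branches[of r x a] dst_le_eccentricity[of a x] deep V by simp
  next
    case 2
    then show ?thesis
      using dst_distinct_branches[of r x c] dst_le_eccentricity[of c x] deep V by simp
  qed
qed

text \<open>The smaller eccentricity is \<open>d\<close> plus the smaller depth. Across branches the
  distance is the sum of the depths, so equality means that the larger depth is \<open>d\<close>;
  within a branch the distance falls short.\<close>

lemma dst_eq_min_eccentricity_iff:
  assumes V: "r \<in> V" "x \<in> V" "y \<in> V" and d: "d > 0" and ecc: "eccentricity r = d"
    and sum: "\<And>z. z \<in> V \<Longrightarrow> eccentricity z = d + dst r z"
  shows "dst x y = min (eccentricity x) (eccentricity y)
    \<longleftrightarrow> (dst r x = d \<or> dst r y = d) \<and> branch r x \<noteq> branch r y"
proof (cases "branch r x = branch r y")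
  case True
  show ?thesis
  \<comment> \<open>\<open>dst_same_branch\<close> covers only vertices other than the root. The
    root shares its \<open>branch\<close> value with no other vertex, and its distance 0 to itself
    is below \<open>d\<close>.\<close>
  proof (cases "x = r")
    case True
    with \<open>branch r x = branch r y\<close> have "y = r" using branch_eq_root_iff V by metis
    then show ?thesis using True sum V d by simp
  next
    case False
    then have "dst x y + 2 \<le> dst r x + dst r y" using True dst_same_branch V by blast
    moreover have "dst r x \<le> d" "dst r y \<le> d" using dst_le_eccentricity[of _ r] V ecc by auto
    ultimately show ?thesis using True sum V by auto
  qed
next
  case False
  moreover have "dst r x \<le> d" "dst r y \<le> d" using dst_le_eccentricity[of _ r] V ecc by auto
  ultimately show ?thesis using dst_distinct_branches[OF V False] sum V by auto
qed

text \<open>A shortest walk from \<open>v\<close> to \<open>x\<close> cannot visit \<open>r\<close>,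
  which is farther from \<open>x\<close> than \<open>v\<close> is. It therefore stays inside the
  branch, and restricting to the branch leaves the distance from \<open>v\<close> unchanged.\<close>

lemma branch_distance:
  assumes rv: "(r, v) \<in> A" and S: "S = {x \<in> V. x \<noteq> r \<and> branch r x = v}" and x: "x \<in> S"
  shows "(LEAST k. (v, x) \<in> {(y, z) \<in> A. y \<in> S \<and> z \<in> S} ^^ k) = dst r x - 1"
proof -
  let ?B = "{(y, z) \<in> A. y \<in> S \<and> z \<in> S}"
  have V: "r \<in> V" "x \<in> V" "x \<noteq> r" "v \<in> V" "branch r x = v" and v: "v \<in> S"
    using rv x A_in_V irrefl_A branch_adjacent by (auto simp: S)
  define k where "k = dst v x"
  have k: "dst r x = Suc k" using branch_properties(3)[OF V(1-3)] V by (simp add: k_def)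
  have "\<not> (r, x) \<in> A ^^ j" if "j \<le> k" for j
    using dst_le[of r x j] k that by auto
  then have avoid: "(v, x) \<in> avoid r ^^ k"
    using walk_avoids_or_visits[OF relpow_dst[OF V(4,2)], of r] by (metis k_def le_add2)
  have "(v, z) \<in> ?B ^^ j \<and> z \<in> S" if "(v, z) \<in> avoid r ^^ j" for z j
    using that
  proof (induction j arbitrary: z)
    case 0
    then show ?case using v by simp
  next
    case (Suc j)
    then obtain y where y: "(v, y) \<in> avoid r ^^ j" "(y, z) \<in> avoid r" by auto
    with Suc.IH have *: "(v, y) \<in> ?B ^^ j" "y \<in> S" by auto
    moreover have "(y, z) \<in> A" "z \<in> S"
      using y(2) *(2) avoid_branch[of r y z] V(1) A_in_V by (auto simp: S avoid_def)
    ultimately show ?case by auto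
  qed
  with avoid have "(v, x) \<in> ?B ^^ k" by blast
  moreover have "k \<le> j" if "(v, x) \<in> ?B ^^ j" for j
  proof -
    have "(v, z) \<in> ?B ^^ j \<Longrightarrow> (v, z) \<in> A ^^ j" for z
      by (induction j arbitrary: z) auto
    then show ?thesis using dst_le[of v x j] that by (auto simp: k_def)
  qed
  ultimately have "(LEAST k. (v, x) \<in> ?B ^^ k) = k" by (intro Least_equality)
  then show ?thesis using k by simp
qed

text \<open>The branch of \<open>v\<close> meets \<open>r\<close> only in the edge at
  \<open>v\<close>, which is deleted because \<open>v \<in> W\<close>, while every arc avoiding
  \<open>r\<close> survives.\<close>

lemma component_eq_branch:
  assumes rv: "(r, v) \<in> A" and "v \<in> W"
  shows "(v, x) \<in> (A - ({r} \<times> W \<union> W \<times> {r}))\<^sup>* \<longleftrightarrow> x \<in> V \<and> x \<noteq> r \<and> branch r x = v"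
    (is "_ \<in> ?B\<^sup>* \<longleftrightarrow> _")
proof
  assume "(v, x) \<in> ?B\<^sup>*"
  then show "x \<in> V \<and> x \<noteq> r \<and> branch r x = v"
  proof (induction rule: rtrancl_induct)
    case base
    then show ?case using rv A_in_V irrefl_A branch_adjacent by auto
  next
    case (step y z)
    have "z \<noteq> r"
    proof
      assume "z = r"
      with step have "(r, y) \<in> A" using A_symD by auto
      then have "y = v" using step branch_adjacent by metis
      then show False using step \<open>z = r\<close> assms by auto
    qed
    then have "(y, z) \<in> avoid r" using step by (auto simp: avoid_def)
    then show ?case using avoid_branch[of r y z] step rv A_in_V \<open>z \<noteq> r\<close> by auto
  qed
next
  assume "x \<in> V \<and> x \<noteq> r \<and> branch r x = v"
  then have "(v, x) \<in> (avoid r)\<^sup>*" using branch_properties(2)[of r x] rv A_in_V by auto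
  moreover have "avoid r \<subseteq> ?B" by (auto simp: avoid_def)
  ultimately show "(v, x) \<in> ?B\<^sup>*" using rtrancl_mono by blast
qed

end

section \<open>From walks in digraphs to powers of the arc relation\<close>

lemma (in wf_digraph) awalk_iff_relpow:
  assumes "x \<in> verts G"
  shows "(\<exists>p. awalk x p y \<and> length p = k) \<longleftrightarrow> (x, y) \<in> arcs_ends G ^^ k"
  using assms
proof (induction k arbitrary: x)
  case 0
  then show ?case by (auto simp: awalk_Nil_iff)
next
  case (Suc k)
  show ?case
  proof
    assume "\<exists>p. awalk x p y \<and> length p = Suc k"
    then obtain e p where e: "awalk x (e # p) y" "length p = k" by (auto simp: length_Suc_conv)
    then have "(x, head G e) \<in> arcs_ends G" "awalk (head G e) p y" "head G e \<in> verts G"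
      by (auto simp: awalk_Cons_iff arcs_ends_conv)
    then show "(x, y) \<in> arcs_ends G ^^ Suc k" using Suc.IH[of "head G e"] e(2) relpow_Suc_I2 by metis
  next
    assume "(x, y) \<in> arcs_ends G ^^ Suc k"
    then obtain z where z: "(x, z) \<in> arcs_ends G" "(z, y) \<in> arcs_ends G ^^ k"
      using relpow_Suc_D2 by metis
    then obtain e where e: "e \<in> arcs G" "tail G e = x" "head G e = z" by auto
    then obtain p where "awalk z p y" "length p = k" using Suc.IH[of z] z(2) by auto
    then have "awalk x (e # p) y \<and> length (e # p) = Suc k" using e by (auto simp: awalk_Cons_iff)
    then show "\<exists>p. awalk x p y \<and> length p = Suc k" by blast
  qed
qed

lemma (in wf_digraph) gdist_eq_relpow:
  "x \<in> verts G \<Longrightarrow> gdist G x y = (LEAST k. (x, y) \<in> arcs_ends G ^^ k)"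
  unfolding gdist_def by (simp add: awalk_iff_relpow)

text \<open>For acyclicity, a walk between two neighbours of \<open>r\<close> that avoids
  \<open>r\<close> is shortened to a path and closed up through \<open>r\<close> to a forbidden
  cycle.\<close>

lemma simple_tree_imp_tree_relation:
  assumes "simple_tree T"
  shows "tree_relation (pverts T) (parcs T)"
proof -
  interpret pair_graph T using assms by (simp add: simple_tree_def)
  have conn: "Digraph_Component.connected (with_proj T)"
    and nocyc: "\<And>p. cycle p \<Longrightarrow> length p < 3"
    using assms by (auto simp: simple_tree_def not_le)
  show ?thesis
  proof
    show "finite (pverts T)" by (rule pair_finite_verts)
    show "parcs T \<subseteq> pverts T \<times> pverts T" by (auto intro: in_arcsD1 in_arcsD2)
    show "sym (parcs T)" by (auto intro: symI arcs_symmetric)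
    show "(x, x) \<notin> parcs T" for x using no_loops' by blast
    show "(x, y) \<in> (parcs T)\<^sup>*" if "x \<in> pverts T" "y \<in> pverts T" for x y
    proof -
      \<comment> \<open>Connectedness means strong connectedness of the symmetric closure, which
        adds no arcs to a graph that is already symmetric.\<close>
      have "x \<rightarrow>\<^sup>*\<^bsub>with_proj (mk_symmetric (with_proj T))\<^esub> y"
        using conn that by (auto simp: connected_def strongly_connected_def mk_symmetric_def)
      then have "(x, y) \<in> (parcs (mk_symmetric (with_proj T)))\<^sup>*"
        using reachable_rtranclI by fastforce
      moreover have "parcs (mk_symmetric (with_proj T)) \<subseteq> parcs T"
        using arcs_symmetric by (auto simp: mk_symmetric_def)
      ultimately show ?thesis using rtrancl_mono by blast
    qed
    fix r u u'
    assume r: "(r, u) \<in> parcs T" "(r, u') \<in> parcs T"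
      and uu': "(u, u') \<in> {(x, y) \<in> parcs T. x \<noteq> r \<and> y \<noteq> r}\<^sup>*"
    show "u = u'"
    proof (rule ccontr)
      assume "u \<noteq> u'"
      have "u \<noteq> r" "u' \<in> pverts T" using r no_loops' in_arcsD2 by blast+
      from uu' have "\<exists>p. awalk u p u' \<and> (\<forall>e\<in>set p. fst e \<noteq> r \<and> snd e \<noteq> r)"
      proof (induction rule: converse_rtrancl_induct)
        case base
        then show ?case using \<open>u' \<in> pverts T\<close>
          by (intro exI[of _ "[]"]) (auto simp: awalk_Nil_iff)
      next
        case (step x y)
        then obtain p where "awalk y p u'" "\<forall>e\<in>set p. fst e \<noteq> r \<and> snd e \<noteq> r" by blast
        then show ?case using step(1) in_arcsD1
          by (intro exI[of _ "(x, y) # p"]) (auto simp: awalk_Cons_iff)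
      qed
      then obtain p where p: "awalk u p u'" "\<forall>e\<in>set p. fst e \<noteq> r \<and> snd e \<noteq> r" by blast
      \<comment> \<open>A path supplies the distinct vertices that a cycle requires, and its arcs
        are among those of \<open>p\<close>, so it still avoids \<open>r\<close>.\<close>
      define q where "q = awalk_to_apath p"
      have q: "apath u q u'" "\<forall>e\<in>set q. fst e \<noteq> r \<and> snd e \<noteq> r"
        using apath_awalk_to_apath[OF p(1)] awalk_to_apath_subset[OF p(1)] p(2)
        by (auto simp: q_def)
      have rq: "r \<notin> set (awalk_verts u q)"
        using q \<open>u \<noteq> r\<close> set_awalk_verts[of u q u'] by (auto simp: apath_def)
      from q(1) have aw: "awalk u q u'" and dist: "distinct (awalk_verts u q)" by (auto simp: apath_def)
      have "q \<noteq> []" using aw \<open>u \<noteq> u'\<close> by (auto simp: awalk_Nil_iff)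
      have u'r: "(u', r) \<in> parcs T" using r(2) arcs_symmetric by blast
      \<comment> \<open>As \<open>u \<noteq> u'\<close>, the path \<open>q\<close> has at least one
        arc, so this closed walk has at least three and is no mere edge traversed back and
        forth.\<close>
      let ?c = "(r, u) # q @ [(u', r)]"
      have "awalk r ?c r"
        using aw r u'r in_arcsD1 by (auto simp: awalk_Cons_iff awalk_Nil_iff)
      moreover have "awalk_verts u (q @ [(u', r)]) = awalk_verts u q @ [r]"
        using aw u'r awalk_verts_append[of u q "[(u', r)]" r] in_arcsD2 awalk_appendI
        by (auto simp: awalk_Cons_iff awalk_Nil_iff)
      ultimately have "cycle ?c" unfolding cycle_def using dist rq by (intro exI[of _ r]) auto
      from nocyc[OF this] \<open>q \<noteq> []\<close> show False by (cases q) auto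
    qed
  qed
qed

section \<open>The eccentricity matrix\<close>

text \<open>The component of \<open>v\<close> is its whole branch, where distances from
  \<open>v\<close> are one less than depths measured from \<open>r\<close>.\<close>

lemma ecc_branch_component:
  assumes T: "simple_tree T" and rv: "(r, v) \<in> parcs T" and "v \<in> W"
  defines "C \<equiv> component_of (with_proj (delete_star T r W)) v"
  defines "S \<equiv> {x \<in> pverts T. x \<noteq> r \<and> tree_relation.branch (parcs T) r x = v}"
  shows "ecc C v = Max ((\<lambda>x. tree_relation.dst (parcs T) r x - 1) ` S)"
proof -
  interpret pair_graph T using T by (simp add: simple_tree_def)
  interpret R: tree_relation "pverts T" "parcs T" by (rule simple_tree_imp_tree_relation[OF T])
  let ?F = "delete_star T r W"
  have pv: "pverts ?F = pverts T"
    and pa: "parcs ?F = parcs T - ({r} \<times> W \<union> W \<times> {r})" by (simp_all add: delete_star_def)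
  interpret F: pair_sym_digraph ?F
  proof
    show "symmetric (with_proj ?F)"
      using arcs_symmetric by (auto simp: symmetric_def pa intro!: symI)
  qed (auto simp: pv pa intro: in_arcsD1 in_arcsD2)
  have reach: "v \<rightarrow>\<^sup>*\<^bsub>with_proj ?F\<^esub> x \<longleftrightarrow> (v, x) \<in> (parcs ?F)\<^sup>*" for x
  proof
    assume "(v, x) \<in> (parcs ?F)\<^sup>*"
    then show "v \<rightarrow>\<^sup>*\<^bsub>with_proj ?F\<^esub> x"
      using in_arcsD2[OF rv] by (induction rule: rtrancl_induct) (auto simp: pv intro: F.reachable_adj_trans)
  qed (use reachable_rtranclI in fastforce)
  have "x \<rightarrow>\<^sup>*\<^bsub>with_proj ?F\<^esub> v" if "v \<rightarrow>\<^sup>*\<^bsub>with_proj ?F\<^esub> x" for x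
    using symmetric_reachable[OF F.pair_sym_arcs that] .
  \<comment> \<open>Reachability is symmetric here, so the strong component is the set reachable
    from \<open>v\<close>.\<close>
  then have scc: "F.scc_of v = S"
    using reach R.component_eq_branch[OF rv \<open>v \<in> W\<close>] unfolding F.scc_of_def S_def pa by blast
  have SV: "S \<subseteq> pverts T" by (auto simp: S_def)
  have C: "C = with_proj ?F \<restriction> S" by (simp add: C_def component_of_def scc)
  interpret C: wf_digraph C
    unfolding C by unfold_locales auto
  \<comment> \<open>Every deleted arc has an end at \<open>r\<close>, which lies outside
    \<open>S\<close>, so no arc inside the branch is lost.\<close>
  have ends: "arcs_ends C = {(y, z) \<in> parcs T. y \<in> S \<and> z \<in> S}"
    using \<open>v \<in> W\<close> by (auto simp: C arcs_ends_conv pa S_def)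
  have vS: "v \<in> S" using rv in_arcsD2 R.branch_adjacent R.irrefl_A by (auto simp: S_def)
  have "gdist C v x = R.dst r x - 1" if "x \<in> S" for x
    using C.gdist_eq_relpow[of v x] R.branch_distance[OF rv S_def[THEN meta_eq_to_obj_eq] that] vS
    by (simp add: ends) (simp add: C)
  then show ?thesis unfolding ecc_def by (simp add: C cong: image_cong_simp)
qed

theorem theorem3p4:
  fixes T :: "'a pair_pre_digraph" and n d l :: nat and u\<^sub>0 :: 'a and U :: "'a set"
    and vs :: "'a list"
  assumes "simple_tree T"
    and "card (pverts T) = n"
    and "d \<ge> 2"
    and "diam (with_proj T) = 2 * d"
    and "u\<^sub>0 \<in> center (with_proj T)"
    and "deep_neighbours T u\<^sub>0 (d - 1) U"
    and "card U = l"
    and "distinct vs" and "set vs = pverts T"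
  shows "inertia (ecc_mat (with_proj T) vs) = (l, l, n - 2 * l)"
proof -
  interpret pair_graph T using assms(1) by (simp add: simple_tree_def)
  interpret R: tree_relation "pverts T" "parcs T" by (rule simple_tree_imp_tree_relation[OF assms(1)])
  let ?V = "pverts T"
  define b where "b = R.branch u\<^sub>0"
  define h where "h = R.dst u\<^sub>0"
  have d: "d > 0" using \<open>d \<ge> 2\<close> by simp
  have gd: "gdist (with_proj T) x y = R.dst x y" if "x \<in> ?V" for x y
    using gdist_eq_relpow[OF that] by (simp add: R.dst_def)
  have ecc: "ecc (with_proj T) x = R.eccentricity x" if "x \<in> ?V" for x
    using that by (simp add: ecc_def R.eccentricity_def gd)
  have r: "u\<^sub>0 \<in> ?V" using \<open>u\<^sub>0 \<in> center _\<close> by (simp add: center_def)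
  have min: "R.eccentricity u\<^sub>0 \<le> R.eccentricity x" if "x \<in> ?V" for x
    using \<open>u\<^sub>0 \<in> center _\<close> that r by (simp add: center_def ecc)
  let ?D = "(\<lambda>(x, y). gdist (with_proj T) x y) ` (?V \<times> ?V)"
  have D: "finite ?D" "?D \<noteq> {}" "Max ?D = 2 * d"
    using R.finite_V r \<open>diam _ = _\<close> by (auto simp: diam_def)
  \<comment> \<open>The ends of a diametrical path, which supply the two branches at
    \<open>u\<^sub>0\<close> of depth \<open>d\<close>.\<close>
  from Max_in[OF D(1,2)] obtain a c where ac: "a \<in> ?V" "c \<in> ?V" "R.dst a c = 2 * d"
    unfolding D(3) by (auto simp: gd)
  have diam: "R.dst x y \<le> 2 * d" if "x \<in> ?V" "y \<in> ?V" for x y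
    using Max_ge[OF D(1), of "R.dst x y"] that unfolding D(3) by (force simp: gd)
  note center = R.eccentricity_center[OF d ac diam r min]
  have h_le: "h x \<le> d" if "x \<in> ?V" for x
    using R.dst_le_eccentricity[OF that, of u\<^sub>0] center(1) by (simp add: h_def)
  have ecc_add: "R.eccentricity x = d + h x" if "x \<in> ?V" for x
    unfolding h_def using R.eccentricity_eq_add[OF r that ac(1,2) center] .
  have entry: "gdist (with_proj T) x y = min (ecc (with_proj T) x) (ecc (with_proj T) y)
      \<longleftrightarrow> (h x = d \<or> h y = d) \<and> b x \<noteq> b y" if "x \<in> ?V" "y \<in> ?V" for x y
    using R.dst_eq_min_eccentricity_iff[OF r that d center(1)] ecc_add that
    by (simp add: gd ecc h_def b_def)
  have sum: "R.dst x y = h x + h y" if "x \<in> ?V" "y \<in> ?V" "b x \<noteq> b y" for x y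
    using R.dst_distinct_branches[OF r that(1,2)] that(3) by (simp add: h_def b_def)
  have entry_value: "(if gdist (with_proj T) x y = min (ecc (with_proj T) x) (ecc (with_proj T) y)
      then real (gdist (with_proj T) x y) else 0)
      = (if (h x = d \<or> h y = d) \<and> b x \<noteq> b y then real (h x + h y) else 0)"
    if "x \<in> ?V" "y \<in> ?V" for x y
    unfolding entry[OF that] using sum[OF that] gd[OF that(1)] by simp
  have ecc_mat: "ecc_mat (with_proj T) vs = mat n n (\<lambda>(i, j).
      if (h (vs ! i) = d \<or> h (vs ! j) = d) \<and> b (vs ! i) \<noteq> b (vs ! j)
      then real (h (vs ! i) + h (vs ! j)) else 0)"
  proof -
    have len: "length vs = n" using assms distinct_card by metis
    have V: "vs ! i \<in> ?V" if "i < n" for i using that len assms(9) nth_mem by metis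
    show ?thesis unfolding ecc_mat_def len
      by (rule eq_matI) (simp_all add: V entry_value)
  qed
  \<comment> \<open>\<open>U\<close> occurs on both sides of its defining equation. At
    \<open>u\<close>, the deleted set \<open>insert u U\<close> contains \<open>u\<close>, so the
    component is the branch at \<open>u\<close> whatever else \<open>U\<close> contains.\<close>
  have mem_U: "u \<in> U \<longleftrightarrow> (u\<^sub>0, u) \<in> parcs T
      \<and> ecc (component_of (with_proj (delete_star T u\<^sub>0 (insert u U))) u) u = d - 1" for u
    using assms(6) unfolding deep_neighbours_def by (subst (asm) set_eq_iff) simp
  \<comment> \<open>This removes the self-reference: \<open>U\<close> consists of the branches that
    reach depth \<open>d\<close>.\<close>
  have U: "u \<in> U \<longleftrightarrow> (\<exists>x\<in>?V. h x = d \<and> b x = u)" for u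
  proof -
    let ?S = "{x \<in> ?V. x \<noteq> u\<^sub>0 \<and> b x = u}"
    have "u \<in> U \<longleftrightarrow> (u\<^sub>0, u) \<in> parcs T \<and> Max ((\<lambda>x. h x - 1) ` ?S) = d - 1"
      unfolding mem_U b_def h_def
      using ecc_branch_component[OF assms(1), of u\<^sub>0 u "insert u U"] by auto
    also have "\<dots> \<longleftrightarrow> (u\<^sub>0, u) \<in> parcs T \<and> (\<exists>x\<in>?S. h x = d)"
    proof (rule conj_cong[OF refl])
      assume u: "(u\<^sub>0, u) \<in> parcs T"
      then have "u \<in> ?S" using in_arcsD2 no_loops' R.branch_adjacent by (auto simp: b_def)
      moreover have "finite ?S" using R.finite_V by simp
      ultimately have "Max ((\<lambda>x. h x - 1) ` ?S) = d - 1
          \<longleftrightarrow> d - 1 \<in> (\<lambda>x. h x - 1) ` ?S \<and> (\<forall>k\<in>(\<lambda>x. h x - 1) ` ?S. k \<le> d - 1)"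
        by (intro Max_eq_iff) auto
      \<comment> \<open>No depth exceeds \<open>d\<close>, so the bound on the maximum always holds
        and only its attainment is left.\<close>
      also have "\<dots> \<longleftrightarrow> (\<exists>x\<in>?S. h x - 1 = d - 1)"
        using h_le by (force intro: diff_le_mono)
      also have "\<dots> \<longleftrightarrow> (\<exists>x\<in>?S. h x = d)"
      proof (rule bex_cong[OF refl])
        fix x assume "x \<in> ?S"
        \<comment> \<open>Positive depth means that \<open>h x - 1\<close> is not truncated at 0, so
          the subtraction can be undone on both sides.\<close>
        then have "h x > 0" using R.branch_properties(3)[OF r, of x] by (simp add: h_def)
        then show "h x - 1 = d - 1 \<longleftrightarrow> h x = d" using d by auto
      qed
      finally show "Max ((\<lambda>x. h x - 1) ` ?S) = d - 1 \<longleftrightarrow> (\<exists>x\<in>?S. h x = d)" .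
    qed
    also have "\<dots> \<longleftrightarrow> (\<exists>x\<in>?V. h x = d \<and> b x = u)"
    proof -
      have "x \<noteq> u\<^sub>0" if "h x = d" for x using that d by (auto simp: h_def)
      then show ?thesis using R.branch_properties(1)[OF r] by (auto simp: b_def)
    qed
    finally show ?thesis .
  qed
  have U_arc: "(u\<^sub>0, u) \<in> parcs T" if "u \<in> U" for u
    using that mem_U by blast
  have len: "length vs = n" using assms distinct_card by metis
  have ex_nth: "\<exists>i<n. P (vs ! i)" if "x \<in> ?V" "P x" for x P
    using that unfolding assms(9)[symmetric] in_set_conv_nth len by blast
  obtain i where i: "i < n" "vs ! i = u\<^sub>0" using ex_nth[of u\<^sub>0 "\<lambda>x. x = u\<^sub>0"] r by auto
  show ?thesis
    unfolding ecc_mat \<open>card U = l\<close>[symmetric]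
  proof (rule inertia_branch_matrix)
    show "finite U" using U_arc in_arcsD2 by (intro finite_subset[OF _ R.finite_V]) auto
    show "i < n" "0 < d" by fact+
    show "h (vs ! i) = 0" using i by (simp add: h_def)
    \<comment> \<open>The center is its own \<open>branch\<close> value, and it is not its own
      neighbour.\<close>
    show "b (vs ! i) \<notin> U" using i U_arc no_loops' by (auto simp: b_def)
    show "b (vs ! j) \<in> U" if "j < n" "h (vs ! j) = d" for j
    proof -
      have "vs ! j \<in> ?V" using that(1) len assms(9) nth_mem by metis
      then show ?thesis using that(2) U by blast
    qed
    show "\<exists>j<n. h (vs ! j) = d \<and> b (vs ! j) = u" if "u \<in> U" for u
    proof -
      from that U obtain x where "x \<in> ?V" "h x = d \<and> b x = u" by blast
      then show ?thesis by (rule ex_nth)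
    qed
    show "\<exists>j<n. h (vs ! j) \<noteq> d \<and> b (vs ! j) = u" if "u \<in> U" for u
    proof (rule ex_nth)
      show "u \<in> ?V" using in_arcsD2[OF U_arc[OF that]] .
      \<comment> \<open>The shallow vertex of the branch is \<open>u\<close> itself, at depth 1,
        which differs from \<open>d\<close> because \<open>d \<ge> 2\<close>.\<close>
      show "h u \<noteq> d \<and> b u = u"
        using R.dst_adjacent[OF U_arc[OF that]] R.branch_adjacent[OF U_arc[OF that]] \<open>d \<ge> 2\<close>
        by (simp add: h_def b_def)
    qed
  qed
qed

end
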